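(* Let $n\geq 2$. The groups $UVB_n$ and $UVP_n$ are residually finite and Hopfian, but not co-Hopfian.
   Context: The unrestricted virtual braid group $UVB_n$ is the group with generators $\sigma_1,\dots,\sigma_{n-1},\rho_1,\dots,\rho_{n-1}$ and relations: $\sigma_i\sigma_{i+1}\sigma_i=\sigma_{i+1}\sigma_i\sigma_{i+1}$ ($1\le i\le n-2$); $\sigma_i\sigma_j=\sigma_j\sigma_i$ ($|i-j|>1$); $\rho_i\rho_{i+1}\rho_i=\rho_{i+1}\rho_i\rho_{i+1}$ ($1\le i\le n-2$); $\rho_i\rho_j=\rho_j\rho_i$ ($|i-j|>1$); $\rho_i^2=1$ ($1\le i\le n-1$); $\sigma_i\rho_j=\rho_j\sigma_i$ ($|i-j|>1$); $\sigma_i\rho_{i+1}\rho_i=\rho_{i+1}\rho_i\sigma_{i+1}$ ($1\le i\le n-2$); $\rho_i\sigma_{i+1}\sigma_i=\sigma_{i+1}\sigma_i\rho_{i+1}$ ($1\le i\le n-2$); $\rho_{i+1}\sigma_i\sigma_{i+1}=\sigma_i\sigma_{i+1}\rho_i$ ($1\le i\le n-2$). The unrestricted virtual pure braid group $UVP_n$ is the kernel of the homomorphism $\phi:UVB_n\to S_n$ with $\phi(\sigma_i)=\phi(\rho_i)=(i,i+1)$ for $1\le i\le n-1$. A group $G$ is Hopfian if every surjective homomorphism $G\to G$ is injective, and co-Hopfian if every injective homomorphism $G\to G$ is surjective. *)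

theory Defs
  imports "HOL-Algebra.Sym_Groups"
begin

section \<open>Groups given by generators and relations\<close>

text \<open>A letter \<open>(x, True)\<close> stands for the generator \<open>x\<close>, and \<open>(x, False)\<close> for its inverse.
  A relation \<open>u = v\<close> is the pair \<open>(u, v)\<close>.\<close>

type_synonym 'g word = "('g \<times> bool) list"

definition words :: "'g set \<Rightarrow> 'g word set" where
  "words X = lists (X \<times> UNIV)"

inductive word_eq :: "'g set \<Rightarrow> ('g word \<times> 'g word) set \<Rightarrow> 'g word \<Rightarrow> 'g word \<Rightarrow> bool"
  for X :: "'g set" and R :: "('g word \<times> 'g word) set" where
  refl: "w \<in> words X \<Longrightarrow> word_eq X R w w"
| sym: "word_eq X R u v \<Longrightarrow> word_eq X R v u"
| trans: "word_eq X R u v \<Longrightarrow> word_eq X R v w \<Longrightarrow> word_eq X R u w"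
| append: "word_eq X R u u' \<Longrightarrow> word_eq X R v v' \<Longrightarrow> word_eq X R (u @ v) (u' @ v')"
| cancel: "x \<in> X \<Longrightarrow> word_eq X R [(x, b), (x, \<not> b)] []"
| rel: "(u, v) \<in> R \<Longrightarrow> u \<in> words X \<Longrightarrow> v \<in> words X \<Longrightarrow> word_eq X R u v"

definition word_class :: "'g set \<Rightarrow> ('g word \<times> 'g word) set \<Rightarrow> 'g word \<Rightarrow> 'g word set" where
  "word_class X R w = {v. word_eq X R w v}"

definition presented_group :: "'g set \<Rightarrow> ('g word \<times> 'g word) set \<Rightarrow> 'g word set monoid" where
  "presented_group X R =
     \<lparr>carrier = word_class X R ` words X,
      mult = (\<lambda>A B. \<Union>u\<in>A. \<Union>v\<in>B. word_class X R (u @ v)),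
      one = word_class X R []\<rparr>"

definition word_value :: "('a, 'm) monoid_scheme \<Rightarrow> ('g \<Rightarrow> 'a) \<Rightarrow> 'g word \<Rightarrow> 'a" where
  "word_value G f w =
     foldr (\<lambda>(x, b) g. (if b then f x else inv\<^bsub>G\<^esub> (f x)) \<otimes>\<^bsub>G\<^esub> g) w \<one>\<^bsub>G\<^esub>"

text \<open>The homomorphism extending an assignment \<open>f\<close> of the generators that respects the
  relations; see \<open>presented_lift_hom\<close> and \<open>presented_lift_gen\<close> below.\<close>

definition presented_lift :: "('a, 'm) monoid_scheme \<Rightarrow> ('g \<Rightarrow> 'a) \<Rightarrow> 'g word set \<Rightarrow> 'a" where
  "presented_lift G f C = the_elem (word_value G f ` C)"

lemma words_append [simp]: "u @ v \<in> words X \<longleftrightarrow> u \<in> words X \<and> v \<in> words X"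
  by (auto simp: words_def)

lemma words_Nil [simp]: "[] \<in> words X"
  by (simp add: words_def)

lemma words_Cons [simp]: "l # w \<in> words X \<longleftrightarrow> fst l \<in> X \<and> w \<in> words X"
  by (cases l) (auto simp: words_def)

lemma word_eq_words: "word_eq X R u v \<Longrightarrow> u \<in> words X \<and> v \<in> words X"
  by (induction rule: word_eq.induct) auto

lemma word_class_eq_iff:
  "u \<in> words X \<Longrightarrow> word_class X R u = word_class X R v \<longleftrightarrow> word_eq X R u v"
  unfolding word_class_def by (auto intro: word_eq.intros)

lemma presented_group_carrier: "carrier (presented_group X R) = word_class X R ` words X"
  by (simp add: presented_group_def)

lemma presented_group_one: "\<one>\<^bsub>presented_group X R\<^esub> = word_class X R []"
  by (simp add: presented_group_def)

lemma presented_group_mult: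
  assumes u: "u \<in> words X" and v: "v \<in> words X"
  shows "word_class X R u \<otimes>\<^bsub>presented_group X R\<^esub> word_class X R v = word_class X R (u @ v)"
proof -
  have eq: "word_class X R (u' @ v') = word_class X R (u @ v)"
    if "u' \<in> word_class X R u" "v' \<in> word_class X R v" for u' v'
  proof -
    have "word_eq X R (u @ v) (u' @ v')"
      using that by (simp add: word_class_def word_eq.append)
    then show ?thesis
      using word_class_eq_iff[of "u @ v" X R "u' @ v'"] u v by simp
  qed
  have "u \<in> word_class X R u" "v \<in> word_class X R v"
    using u v by (simp_all add: word_class_def word_eq.refl)
  then have "(\<Union>u'\<in>word_class X R u. \<Union>v'\<in>word_class X R v. word_class X R (u' @ v')) =
      word_class X R (u @ v)"
    using eq by blast
  then show ?thesis
    by (simp add: presented_group_def)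
qed

lemma word_left_inverse:
  "w \<in> words X \<Longrightarrow> \<exists>v\<in>words X. word_eq X R (v @ w) []"
proof (induction w)
  case Nil
  show ?case by (rule bexI[of _ "[]"]) (auto intro: word_eq.refl)
next
  case (Cons l w)
  then obtain v where v: "v \<in> words X" "word_eq X R (v @ w) []" by auto
  obtain x b where l: "l = (x, b)" by fastforce
  have x: "x \<in> X" using Cons.prems l by simp
  have w: "w \<in> words X" using Cons.prems by simp
  have "word_eq X R ([(x, \<not> b), (x, b)] @ w) ([] @ w)"
    using word_eq.cancel[OF x, of R "\<not> b"] w by (intro word_eq.append word_eq.refl) auto
  then have "word_eq X R (v @ ([(x, \<not> b), (x, b)] @ w)) (v @ w)"
    using v(1) by (intro word_eq.append word_eq.refl) auto
  then have "word_eq X R ((v @ [(x, \<not> b)]) @ (l # w)) []"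
    using v(2) l by (auto intro: word_eq.trans)
  then show ?case using v(1) x by (intro bexI[of _ "v @ [(x, \<not> b)]"]) auto
qed

lemma word_class_carrier:
  "w \<in> words X \<Longrightarrow> word_class X R w \<in> carrier (presented_group X R)"
  by (simp add: presented_group_carrier)

lemma presented_group_cases:
  assumes "A \<in> carrier (presented_group X R)"
  obtains w where "w \<in> words X" "A = word_class X R w"
  using assms by (auto simp: presented_group_carrier)

lemma group_presented_group: "group (presented_group X R)"
proof (rule groupI)
  let ?P = "presented_group X R"
  fix A B assume "A \<in> carrier ?P" "B \<in> carrier ?P"
  then obtain u v where "u \<in> words X" "A = word_class X R u" "v \<in> words X" "B = word_class X R v"
    by (elim presented_group_cases)
  then show "A \<otimes>\<^bsub>?P\<^esub> B \<in> carrier ?P"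
    by (simp add: presented_group_mult word_class_carrier)
next
  let ?P = "presented_group X R"
  show "\<one>\<^bsub>?P\<^esub> \<in> carrier ?P"
    by (simp add: presented_group_one word_class_carrier)
next
  let ?P = "presented_group X R"
  fix A B C assume "A \<in> carrier ?P" "B \<in> carrier ?P" "C \<in> carrier ?P"
  then obtain u v w where "u \<in> words X" "A = word_class X R u" "v \<in> words X" "B = word_class X R v"
    "w \<in> words X" "C = word_class X R w"
    by (elim presented_group_cases)
  then show "A \<otimes>\<^bsub>?P\<^esub> B \<otimes>\<^bsub>?P\<^esub> C = A \<otimes>\<^bsub>?P\<^esub> (B \<otimes>\<^bsub>?P\<^esub> C)"
    by (simp add: presented_group_mult)
next
  let ?P = "presented_group X R"
  fix A assume "A \<in> carrier ?P"
  then obtain w where w: "w \<in> words X" "A = word_class X R w"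
    by (elim presented_group_cases)
  then show "\<one>\<^bsub>?P\<^esub> \<otimes>\<^bsub>?P\<^esub> A = A"
    by (simp add: presented_group_one presented_group_mult)
  obtain v where v: "v \<in> words X" "word_eq X R (v @ w) []"
    using word_left_inverse w(1) by blast
  have "word_class X R v \<otimes>\<^bsub>?P\<^esub> A = \<one>\<^bsub>?P\<^esub>"
    using v w by (simp add: presented_group_mult presented_group_one word_class_eq_iff)
  then show "\<exists>B\<in>carrier ?P. B \<otimes>\<^bsub>?P\<^esub> A = \<one>\<^bsub>?P\<^esub>"
    using word_class_carrier[OF v(1)] by blast
qed

context
  fixes G :: "('a, 'm) monoid_scheme" (structure) and f :: "'g \<Rightarrow> 'a"
    and X :: "'g set" and R :: "('g word \<times> 'g word) set"
  assumes G: "group G"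
    and f: "\<And>x. x \<in> X \<Longrightarrow> f x \<in> carrier G"
    and rels: "\<And>u v. (u, v) \<in> R \<Longrightarrow> u \<in> words X \<Longrightarrow> v \<in> words X \<Longrightarrow>
      word_value G f u = word_value G f v"
begin

interpretation group G by (rule G)

lemma word_value_closed: "w \<in> words X \<Longrightarrow> word_value G f w \<in> carrier G"
  by (induction w) (auto simp: word_value_def f)

lemma word_value_append:
  "u \<in> words X \<Longrightarrow> v \<in> words X \<Longrightarrow>
    word_value G f (u @ v) = word_value G f u \<otimes> word_value G f v"
proof (induction u)
  case Nil
  then show ?case using word_value_closed[of v] by (simp add: word_value_def)
next
  case (Cons l u)
  then show ?case using word_value_closed[of u] word_value_closed[of v]
    by (cases l) (auto simp: word_value_def f m_assoc)
qed

lemma word_value_word_eq: "word_eq X R u v \<Longrightarrow> word_value G f u = word_value G f v"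
proof (induction rule: word_eq.induct)
  case (append u u' v v')
  then have "u \<in> words X" "u' \<in> words X" "v \<in> words X" "v' \<in> words X"
    using word_eq_words by blast+
  with append.IH show ?case by (simp add: word_value_append)
next
  case (cancel x b)
  then show ?case using f[of x] by (cases b) (simp_all add: word_value_def)
next
  case (rel u v)
  then show ?case by (rule rels)
qed simp_all

lemma presented_lift_class:
  assumes w: "w \<in> words X"
  shows "presented_lift G f (word_class X R w) = word_value G f w"
proof -
  have "w \<in> word_class X R w"
    using w by (simp add: word_class_def word_eq.refl)
  moreover have "word_value G f v = word_value G f w" if "v \<in> word_class X R w" for v
    using that word_value_word_eq[of w v] by (simp add: word_class_def)
  ultimately have "word_value G f ` word_class X R w = {word_value G f w}"
    by blast
  then show ?thesis by (simp add: presented_lift_def)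
qed

lemma presented_lift_hom: "presented_lift G f \<in> hom (presented_group X R) G"
proof (rule homI)
  fix A assume "A \<in> carrier (presented_group X R)"
  then show "presented_lift G f A \<in> carrier G"
    by (elim presented_group_cases) (simp add: presented_lift_class word_value_closed)
next
  fix A B assume "A \<in> carrier (presented_group X R)" "B \<in> carrier (presented_group X R)"
  then obtain u v where "u \<in> words X" "A = word_class X R u" "v \<in> words X" "B = word_class X R v"
    by (elim presented_group_cases)
  then show "presented_lift G f (A \<otimes>\<^bsub>presented_group X R\<^esub> B) =
      presented_lift G f A \<otimes> presented_lift G f B"
    by (simp add: presented_lift_class presented_group_mult word_value_append)
qed

lemma presented_lift_gen:
  "x \<in> X \<Longrightarrow> presented_lift G f (word_class X R [(x, True)]) = f x"
  by (simp add: presented_lift_class) (simp add: word_value_def f)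

end


section \<open>Unrestricted virtual braid groups\<close>

datatype uvb_gen = Sig nat | Rho nat

abbreviation sg :: "nat \<Rightarrow> uvb_gen \<times> bool" where "sg i \<equiv> (Sig i, True)"
abbreviation rh :: "nat \<Rightarrow> uvb_gen \<times> bool" where "rh i \<equiv> (Rho i, True)"

definition uvb_gens :: "nat \<Rightarrow> uvb_gen set" where
  "uvb_gens n = Sig ` {1..n - 1} \<union> Rho ` {1..n - 1}"

definition far :: "nat \<Rightarrow> nat \<Rightarrow> nat \<Rightarrow> bool" where
  "far n i j \<longleftrightarrow> i \<in> {1..n - 1} \<and> j \<in> {1..n - 1} \<and> \<bar>int i - int j\<bar> > 1"

definition uvb_rels :: "nat \<Rightarrow> (uvb_gen word \<times> uvb_gen word) set" where
  "uvb_rels n =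
     {([sg i, sg (i+1), sg i], [sg (i+1), sg i, sg (i+1)]) | i. i \<in> {1..n - 2}} \<union>
     {([sg i, sg j], [sg j, sg i]) | i j. far n i j} \<union>
     {([rh i, rh (i+1), rh i], [rh (i+1), rh i, rh (i+1)]) | i. i \<in> {1..n - 2}} \<union>
     {([rh i, rh j], [rh j, rh i]) | i j. far n i j} \<union>
     {([rh i, rh i], []) | i. i \<in> {1..n - 1}} \<union>
     {([sg i, rh j], [rh j, sg i]) | i j. far n i j} \<union>
     {([sg i, rh (i+1), rh i], [rh (i+1), rh i, sg (i+1)]) | i. i \<in> {1..n - 2}} \<union>
     {([rh i, sg (i+1), sg i], [sg (i+1), sg i, rh (i+1)]) | i. i \<in> {1..n - 2}} \<union>
     {([rh (i+1), sg i, sg (i+1)], [sg i, sg (i+1), rh i]) | i. i \<in> {1..n - 2}}"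

definition UVB :: "nat \<Rightarrow> uvb_gen word set monoid" where
  "UVB n = presented_group (uvb_gens n) (uvb_rels n)"

fun gen_perm :: "uvb_gen \<Rightarrow> nat \<Rightarrow> nat" where
  "gen_perm (Sig i) = transpose i (i + 1)"
| "gen_perm (Rho i) = transpose i (i + 1)"

definition uvb_perm :: "nat \<Rightarrow> uvb_gen word set \<Rightarrow> nat \<Rightarrow> nat" where
  "uvb_perm n = presented_lift (sym_group n) gen_perm"

definition UVP :: "nat \<Rightarrow> uvb_gen word set monoid" where
  "UVP n = (UVB n)\<lparr>carrier := kernel (UVB n) (sym_group n) (uvb_perm n)\<rparr>"

lemma uvb_rels_words: "(u, v) \<in> uvb_rels n \<Longrightarrow> u \<in> words (uvb_gens n) \<and> v \<in> words (uvb_gens n)"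
  by (auto simp: uvb_rels_def uvb_gens_def far_def)

lemma gen_perm_carrier: "x \<in> uvb_gens n \<Longrightarrow> gen_perm x \<in> carrier (sym_group n)"
  by (auto simp: uvb_gens_def sym_group_carrier intro!: permutes_swap_id)

lemma gen_perm_rels:
  "(u, v) \<in> uvb_rels n \<Longrightarrow>
    word_value (sym_group n) gen_perm u = word_value (sym_group n) gen_perm v"
  by (auto simp: uvb_rels_def far_def word_value_def sym_group_mult sym_group_one fun_eq_iff
      transpose_def)

lemma group_UVB: "group (UVB n)"
  by (simp add: UVB_def group_presented_group)

lemma uvb_perm_hom: "uvb_perm n \<in> hom (UVB n) (sym_group n)"
  unfolding UVB_def uvb_perm_def
  by (intro presented_lift_hom sym_group_is_group gen_perm_carrier gen_perm_rels)

lemma uvb_perm_gen: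
  "x \<in> uvb_gens n \<Longrightarrow>
    uvb_perm n (word_class (uvb_gens n) (uvb_rels n) [(x, True)]) = gen_perm x"
  unfolding uvb_perm_def
  by (intro presented_lift_gen sym_group_is_group gen_perm_carrier gen_perm_rels)

lemma group_UVP: "group (UVP n)"
proof -
  interpret group_hom "UVB n" "sym_group n" "uvb_perm n"
    by (simp add: group_hom_def group_hom_axioms_def group_UVB sym_group_is_group uvb_perm_hom)
  show ?thesis
    unfolding UVP_def using subgroup_kernel group_UVB subgroup.subgroup_is_group by blast
qed


section \<open>Residual finiteness and the Hopf properties\<close>

definition residually_finite :: "('a, 'm) monoid_scheme \<Rightarrow> bool" where
  "residually_finite G \<longleftrightarrow>
     (\<forall>g\<in>carrier G. g \<noteq> \<one>\<^bsub>G\<^esub> \<longrightarrow> (\<exists>N. N \<lhd> G \<and> finite (carrier (G Mod N)) \<and> g \<notin> N))"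

definition hopfian :: "('a, 'm) monoid_scheme \<Rightarrow> bool" where
  "hopfian G \<longleftrightarrow>
     (\<forall>f\<in>hom G G. f ` carrier G = carrier G \<longrightarrow> inj_on f (carrier G))"

definition co_hopfian :: "('a, 'm) monoid_scheme \<Rightarrow> bool" where
  "co_hopfian G \<longleftrightarrow>
     (\<forall>f\<in>hom G G. inj_on f (carrier G) \<longrightarrow> f ` carrier G = carrier G)"

end

theory Submission
  imports Defs "HOL-Algebra.Group_Action"
begin

text \<open>Put \<open>\<lambda>\<^sub>i\<^sub>j\<close> for the conjugate of \<open>\<sigma>\<^sub>1\<rho>\<^sub>1\<close> by a product of generators \<open>\<rho>\<close> whose
  permutation carries \<open>(1, 2)\<close> to \<open>(i, j)\<close>. The defining relations make \<open>\<lambda>\<^sub>i\<^sub>j\<close> and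
  \<open>\<lambda>\<^sub>k\<^sub>l\<close> commute unless they concern the same two strands. Hence \<open>UVP\<^sub>n\<close> is
  a direct product of free groups of rank two, one for each unordered pair of strands, and
  \<open>UVB\<^sub>n\<close> is its semidirect product with the symmetric group, which permutes the indices. All
  six claims follow from properties of free groups, provided that they are used in a
  form that is compatible with the action of the symmetric group.

  Only as much of this structure is established as the claims require. Every element is a word in
  the \<open>\<lambda>\<^sub>i\<^sub>j\<close> times a product of generators \<open>\<rho>\<close> (\<open>pure_times_perm_part\<close>), and such
  products are determined by their permutation (\<open>perm_part_inj\<close>). Two permutations \<open>A, B\<close> of a
  finite set of states define a finite permutation representation of \<open>UVB\<^sub>n\<close> on ordered pairs of
  strands with a state: permutations act on the pairs, and \<open>\<lambda>\<^sub>i\<^sub>j\<close> changes the state by \<open>A\<close> over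
  \<open>(i, j)\<close>, by \<open>B\<close> over \<open>(j, i)\<close>, and not at all elsewhere. So over \<open>(i, j)\<close> only the letters
  \<open>\<lambda>\<^sub>i\<^sub>j\<close>, \<open>\<lambda>\<^sub>j\<^sub>i\<close> of a word are visible. In a shortest word they form a reduced word of the free
  group, and a reduced word is moved by suitable finite permutations
  (\<open>reduced_word_moves_point\<close>). Therefore these representations separate the elements, even when
  \<open>A\<close> and \<open>B\<close> are restricted to squares (\<open>separated_by_rep\<close>).

  This gives residual finiteness. Both groups are finitely generated, so they are Hopfian by
  Malcev's theorem. Against the co-Hopf property stands the endomorphism that fixes every \<open>\<rho>\<^sub>i\<close> and
  squares every \<open>\<lambda>\<^sub>i\<^sub>j\<close>. Composed with the representation for \<open>A, B\<close> it is the
  representation for \<open>A\<^sup>2, B\<^sup>2\<close>; since the latter still separate the elements, the endomorphism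
  is well defined and injective. It is not surjective, because the parity of the number of
  letters \<open>\<sigma>\<close> vanishes on its image.\<close>

section \<open>Finitely generated residually finite groups\<close>

lemma hom_eq_on_generate:
  assumes G: "group G" and H: "group H"
    and h: "h \<in> hom G H" and h': "h' \<in> hom G H"
    and S: "S \<subseteq> carrier G" and eq: "\<And>s. s \<in> S \<Longrightarrow> h s = h' s"
    and x: "x \<in> generate G S"
  shows "h x = h' x"
proof -
  interpret h: group_hom G H h
    using G H h by (simp add: group_hom_def group_hom_axioms_def)
  interpret h': group_hom G H h'
    using G H h' by (simp add: group_hom_def group_hom_axioms_def)
  have in_carrier: "y \<in> carrier G" if "y \<in> generate G S" for y
    using that S h.G.generate_in_carrier by blast
  from x show ?thesis
  proof induction
    case one
    show ?case by simp
  next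
    case (incl s)
    then show ?case by (rule eq)
  next
    case (inv s)
    then have "s \<in> carrier G" using S by blast
    then show ?case using eq[OF inv] by simp
  next
    case (eng a b)
    then show ?case by (simp add: in_carrier)
  qed
qed

lemma residually_finite_if_separated:
  assumes G: "group G"
    and sep: "\<And>g. g \<in> carrier G \<Longrightarrow> g \<noteq> \<one>\<^bsub>G\<^esub> \<Longrightarrow>
      \<exists>(H :: 'b monoid) h. group H \<and> finite (carrier H) \<and> h \<in> hom G H \<and> h g \<noteq> \<one>\<^bsub>H\<^esub>"
  shows "residually_finite G"
  unfolding residually_finite_def
proof (intro ballI impI)
  fix g assume g: "g \<in> carrier G" "g \<noteq> \<one>\<^bsub>G\<^esub>"
  then obtain H :: "'b monoid" and h where H: "group H" "finite (carrier H)"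
    and h: "h \<in> hom G H" "h g \<noteq> \<one>\<^bsub>H\<^esub>"
    using sep by blast
  interpret group_hom G H h
    using G H(1) h(1) by (simp add: group_hom_def group_hom_axioms_def)
  have "(\<lambda>X. the_elem (h ` X)) ` carrier (G Mod kernel G H h) \<subseteq> carrier H"
    using FactGroup_the_elem_mem by blast
  then have "finite (carrier (G Mod kernel G H h))"
    using FactGroup_inj_on H(2) by (meson finite_imageD finite_subset)
  moreover have "g \<notin> kernel G H h"
    using h(2) by (simp add: kernel_def)
  ultimately show "\<exists>N. N \<lhd> G \<and> finite (carrier (G Mod N)) \<and> g \<notin> N"
    using normal_kernel by blast
qed

lemma residually_finite_subgroup:
  assumes G: "group G" and K: "subgroup K G" and rf: "residually_finite G"
  shows "residually_finite (G\<lparr>carrier := K\<rparr>)"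
proof (rule residually_finite_if_separated)
  show "group (G\<lparr>carrier := K\<rparr>)"
    using K G by (rule subgroup.subgroup_is_group)
  fix g assume "g \<in> carrier (G\<lparr>carrier := K\<rparr>)" "g \<noteq> \<one>\<^bsub>G\<lparr>carrier := K\<rparr>\<^esub>"
  then have g: "g \<in> K" "g \<in> carrier G" "g \<noteq> \<one>\<^bsub>G\<^esub>"
    using subgroup.subset[OF K] by auto
  then obtain N where N: "N \<lhd> G" "finite (carrier (G Mod N))" "g \<notin> N"
    using rf unfolding residually_finite_def by blast
  interpret N: normal N G by (rule N(1))
  have hom: "(\<lambda>x. N #>\<^bsub>G\<^esub> x) \<in> hom (G\<lparr>carrier := K\<rparr>) (G Mod N)"
    using hom_in_carrier[OF N.r_coset_hom_Mod] hom_mult[OF N.r_coset_hom_Mod] subgroup.subset[OF K]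
    by (intro homI) (simp_all add: subset_iff)
  have "N #>\<^bsub>G\<^esub> g \<noteq> \<one>\<^bsub>G Mod N\<^esub>"
    using N(3) g(2) N.coset_join1 N.is_subgroup by (auto simp: FactGroup_def)
  with N.factorgroup_is_group N(2) hom
  show "\<exists>(H :: 'a set monoid) h. group H \<and> finite (carrier H) \<and>
      h \<in> hom (G\<lparr>carrier := K\<rparr>) H \<and> h g \<noteq> \<one>\<^bsub>H\<^esub>"
    by (intro exI conjI)
qed

text \<open>Malcev's argument. If a surjective endomorphism \<open>f\<close> killed some \<open>g \<noteq> \<one>\<close>, take a
  homomorphism \<open>q\<close> to a finite group with \<open>q g \<noteq> \<one>\<close>. Writing \<open>g = f\<^sup>k x\<close> shows that
  \<open>q \<circ> f\<^sup>k\<close> does not kill \<open>x\<close>, while all \<open>q \<circ> f\<^sup>l\<close> with \<open>l > k\<close> do. So the homomorphisms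
  \<open>q \<circ> f\<^sup>k\<close> are pairwise different, although a finitely generated group has only finitely many
  homomorphisms to a given finite group.\<close>

lemma finitely_generated_residually_finite_imp_hopfian:
  fixes G (structure)
  assumes G: "group G" and fin: "finite S" and S: "S \<subseteq> carrier G"
    and gen: "generate G S = carrier G" and rf: "residually_finite G"
  shows "hopfian G"
  unfolding hopfian_def
proof (intro ballI impI)
  interpret group G by (rule G)
  fix f assume f: "f \<in> hom G G" and surj: "f ` carrier G = carrier G"
  interpret f: group_hom G G f
    using f by unfold_locales
  show "inj_on f (carrier G)"
  proof (unfold f.inj_on_one_iff, intro allI impI, rule ccontr)
    fix g assume g: "g \<in> carrier G" "f g = \<one>" "g \<noteq> \<one>"
    then obtain N where N: "N \<lhd> G" "finite (carrier (G Mod N))" "g \<notin> N"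
      using rf unfolding residually_finite_def by blast
    interpret N: normal N G by (rule N(1))
    define q where "q = (\<lambda>x. N #> x)"
    have q: "q \<in> hom G (G Mod N)"
      unfolding q_def by (rule N.r_coset_hom_Mod)
    have F: "group (G Mod N)" by (rule N.factorgroup_is_group)
    interpret q: group_hom G "G Mod N" q
      using q F group_axioms by (simp add: group_hom_def group_hom_axioms_def)
    have qg: "q g \<noteq> \<one>\<^bsub>G Mod N\<^esub>"
      using N(3) g(1) N.subset by (auto simp: q_def FactGroup_def dest: coset_join1 intro: N.is_subgroup)
    have pow_hom: "f ^^ k \<in> hom G G" for k
    proof (induction k)
      case (Suc k)
      then show ?case using Group.hom_compose[OF Suc f] by (simp only: funpow.simps)
    qed (simp add: hom_def Pi_def)
    have pow_surj: "(f ^^ k) ` carrier G = carrier G" for k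
      by (induction k) (simp, simp only: funpow.simps image_comp[symmetric] surj)
    have comp_hom: "q \<circ> (f ^^ k) \<in> hom G (G Mod N)" for k
      using pow_hom q by (rule Group.hom_compose)
    define \<Phi> where "\<Phi> k = restrict (q \<circ> (f ^^ k)) S" for k
    have "\<Phi> k \<in> S \<rightarrow>\<^sub>E carrier (G Mod N)" for k
      using comp_hom[of k] S unfolding \<Phi>_def hom_def by (auto simp: Pi_iff subset_iff)
    then have "range \<Phi> \<subseteq> S \<rightarrow>\<^sub>E carrier (G Mod N)" by blast
    then have "finite (range \<Phi>)"
      using finite_PiE[of S "\<lambda>_. carrier (G Mod N)"] fin N(2) finite_subset by blast
    then have "\<not> inj \<Phi>"
      using finite_imageD infinite_UNIV_nat by blast
    then obtain k l where kl: "\<Phi> k = \<Phi> l" "k < l"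
      by (metis injI linorder_neqE_nat)
    have agree: "(q \<circ> (f ^^ k)) x = (q \<circ> (f ^^ l)) x" if "x \<in> carrier G" for x
    proof (rule hom_eq_on_generate[OF G F comp_hom comp_hom S])
      show "(q \<circ> (f ^^ k)) s = (q \<circ> (f ^^ l)) s" if "s \<in> S" for s
        using fun_cong[OF kl(1), of s] that by (simp add: \<Phi>_def)
    qed (simp add: gen that)
    obtain x where x: "x \<in> carrier G" "(f ^^ k) x = g"
      using pow_surj[of k] g(1) by (metis imageE)
    obtain m where l: "l = m + Suc k"
      using kl(2) by (metis add.commute less_imp_Suc_add add_Suc_right)
    have "(f ^^ l) x = (f ^^ m) (f ((f ^^ k) x))"
      by (simp add: l funpow_add funpow_swap1)
    also have "\<dots> = (f ^^ m) \<one>"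
      by (simp add: x(2) g(2))
    also have "\<dots> = \<one>"
      by (induction m) simp_all
    finally show False
      using agree[OF x(1)] x(2) qg by simp
  qed
qed


section \<open>Reduced words are detected by finite permutations\<close>

text \<open>The generators act by arbitrary permutations, and the last letter of a word acts first.\<close>

definition word_perm :: "('g \<Rightarrow> 'a \<Rightarrow> 'a) \<Rightarrow> 'g word \<Rightarrow> 'a \<Rightarrow> 'a" where
  "word_perm f w = foldr (\<lambda>(c, b). if b then f c else inv' (f c)) w"

definition reduced :: "'g word \<Rightarrow> bool" where
  "reduced w \<longleftrightarrow> successively (\<lambda>l m. \<not> (fst l = fst m \<and> snd l \<noteq> snd m)) w"

lemma word_perm_Nil [simp]: "word_perm f [] x = x"
  by (simp add: word_perm_def)

lemma word_perm_Cons [simp]: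
  "word_perm f ((c, b) # w) x = (if b then f c else inv' (f c)) (word_perm f w x)"
  by (simp add: word_perm_def)

lemma partial_injection_extends_to_permutation:
  assumes fin: "finite S" and E: "E \<subseteq> S \<times> S"
    and sv: "single_valued E" and sv': "single_valued (E\<inverse>)"
  obtains p where "p permutes S" "\<And>a b. (a, b) \<in> E \<Longrightarrow> p a = b"
proof -
  define D where "D = Domain E"
  define f where "f a = (THE b. (a, b) \<in> E)" for a
  have f: "f a = b" if "(a, b) \<in> E" for a b
    unfolding f_def using that sv by (auto simp: single_valued_def)
  have D: "D \<subseteq> S" and fD: "f ` D \<subseteq> S"
    using E f by (auto simp: D_def)
  have inj: "inj_on f D"
    using f sv' by (auto simp: inj_on_def D_def single_valued_def)
  have "card (S - D) = card (S - f ` D)"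
    using fin D fD inj by (simp add: card_Diff_subset card_image finite_subset)
  then obtain g where g: "bij_betw g (S - D) (S - f ` D)"
    using fin finite_same_card_bij by blast
  define p where "p x = (if x \<in> D then f x else if x \<in> S then g x else x)" for x
  have "bij_betw p D (f ` D)"
    using inj by (auto simp: bij_betw_def p_def inj_on_def)
  moreover have "bij_betw p (S - D) (S - f ` D)"
    using g by (rule bij_betw_cong[THEN iffD1, rotated]) (simp add: p_def)
  ultimately have "bij_betw p (D \<union> (S - D)) (f ` D \<union> (S - f ` D))"
    by (rule bij_betw_combine) blast
  then have "bij_betw p S S"
    using D fD by (simp add: Un_absorb1)
  moreover have "p x = x" if "x \<notin> S" for x
    using that D by (auto simp: p_def)
  ultimately have "p permutes S"
    by (rule bij_imp_permutes)
  moreover have "p a = b" if "(a, b) \<in> E" for a b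
    using that f[OF that] by (auto simp: p_def D_def)
  ultimately show ?thesis by (rule that)
qed

text \<open>A reduced word is spelled along the path \<open>0, 1, \<dots>, length w\<close>, the letter used at time \<open>t\<close>
  being the \<open>t\<close>-th one from the right. The edges that carry a given generator form a partial
  injection: two of them with a common source or target would come from neighbouring mutually
  inverse letters. Extending these partial injections to permutations makes the word move
  \<open>0\<close> to \<open>length w\<close>.\<close>

lemma reduced_word_moves_point:
  fixes w :: "'g word"
  assumes red: "reduced w"
  obtains f :: "'g \<Rightarrow> nat \<Rightarrow> nat"
  where "\<And>c. f c permutes {..length w}" "word_perm f w 0 = length w"
proof -
  define u where "u = rev w"
  have len: "length u = length w" by (simp add: u_def)
  have adj: "\<not> (fst (u ! t) = fst (u ! Suc t) \<and> snd (u ! t) \<noteq> snd (u ! Suc t))"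
    if "Suc t < length u" for t
  proof -
    have "successively (\<lambda>l m. \<not> (fst l = fst m \<and> snd l \<noteq> snd m)) u"
      using red unfolding reduced_def u_def
      by (auto elim: successively_mono)
    then show ?thesis using that
      by (auto dest: successively_nth)
  qed
  define E where "E c = {(t, Suc t) | t. t < length u \<and> u ! t = (c, True)} \<union>
    {(Suc t, t) | t. t < length u \<and> u ! t = (c, False)}" for c
  have noclash: False
    if "t < length u" "Suc t < length u" "u ! t = (c, b)" "u ! Suc t = (c, \<not> b)" for t c b
    using adj[of t] that by simp
  have sv: "single_valued (E c)" for c
    using noclash[of _ c True] noclash[of _ c False]
    by (fastforce simp: single_valued_def E_def)
  have sv': "single_valued ((E c)\<inverse>)" for c
    using noclash[of _ c True] noclash[of _ c False]
    by (fastforce simp: single_valued_def E_def)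
  have "E c \<subseteq> {..length w} \<times> {..length w}" for c
    by (auto simp: E_def len)
  then have "\<exists>p. p permutes {..length w} \<and> (\<forall>a b. (a, b) \<in> E c \<longrightarrow> p a = b)" for c
    by (rule partial_injection_extends_to_permutation[OF finite_atMost _ sv sv']) blast
  then have "\<exists>f. \<forall>c. f c permutes {..length w} \<and> (\<forall>a b. (a, b) \<in> E c \<longrightarrow> f c a = b)"
    by (intro choice) blast
  then obtain f where "\<forall>c. f c permutes {..length w} \<and> (\<forall>a b. (a, b) \<in> E c \<longrightarrow> f c a = b)"
    by (rule exE)
  then have f: "\<And>c. f c permutes {..length w}" "\<And>c a b. (a, b) \<in> E c \<Longrightarrow> f c a = b"
    by auto
  have step: "(if b then f c else inv' (f c)) t = Suc t"
    if "t < length u" "u ! t = (c, b)" for t c b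
  proof (cases b)
    case True
    then show ?thesis using that f(2)[of t "Suc t" c] by (auto simp: E_def)
  next
    case False
    then have "f c (Suc t) = t" using that f(2)[of "Suc t" t c] by (auto simp: E_def)
    then show ?thesis using False permutes_inverses(2)[OF f(1)] by metis
  qed
  have "word_perm f (rev (take t u)) 0 = t" if "t \<le> length u" for t
    using that
  proof (induction t)
    case (Suc t)
    obtain c b where cb: "u ! t = (c, b)" by fastforce
    with Suc step[of t c b] show ?case
      by (simp add: take_Suc_conv_app_nth)
  qed simp
  from this[of "length u"] have "word_perm f w 0 = length w"
    by (simp add: u_def)
  with f(1) show ?thesis by (rule that)
qed

text \<open>Squares of permutations suffice, because doubling every letter keeps a word reduced.\<close>

lemma reduced_word_moves_point_squares:
  fixes w :: "'g word"
  assumes red: "reduced w" and ne: "w \<noteq> []"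
  obtains N and f :: "'g \<Rightarrow> nat \<Rightarrow> nat"
  where "\<And>c. f c permutes {..N}" "word_perm (\<lambda>c. f c \<circ> f c) w 0 \<noteq> 0"
proof -
  define d :: "'g word \<Rightarrow> 'g word" where "d w = concat (map (\<lambda>l. [l, l]) w)" for w
  have "reduced (d w)"
    using red
  proof (induction w)
    case (Cons l w)
    then show ?case by (cases w) (auto simp: d_def reduced_def)
  qed (simp add: d_def reduced_def)
  then obtain f :: "'g \<Rightarrow> nat \<Rightarrow> nat" where f: "\<And>c. f c permutes {..length (d w)}"
    "word_perm f (d w) 0 = length (d w)"
    using reduced_word_moves_point by blast
  have inv: "inv' (\<lambda>y. f c (f c y)) x = inv' (f c) (inv' (f c) x)" for c x
    using o_inv_distrib[OF permutes_bij[OF f(1)] permutes_bij[OF f(1)], of c c]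
    by (simp add: o_def fun_eq_iff)
  have "word_perm f (d v) x = word_perm (\<lambda>c. f c \<circ> f c) v x" for v x
    by (induction v) (auto simp: d_def inv o_def)
  moreover have "length (d w) \<noteq> 0"
    using ne by (cases w) (auto simp: d_def)
  ultimately have "word_perm (\<lambda>c. f c \<circ> f c) w 0 \<noteq> 0"
    using f(2) by metis
  with f(1) show ?thesis by (rule that)
qed

lemma not_reducedE:
  assumes "\<not> reduced w"
  obtains u c b v where "w = u @ (c, b) # (c, \<not> b) # v"
  using assms
proof (induction w arbitrary: thesis)
  case (Cons l w)
  show ?case
  proof (cases "reduced w")
    case True
    with Cons.prems(2) obtain m v where w: "w = m # v" "fst l = fst m" "snd l \<noteq> snd m"
      by (cases w) (auto simp: reduced_def)
    then have "l # w = [] @ (fst l, snd l) # (fst l, \<not> snd l) # v"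
      by (cases l, cases m) auto
    then show ?thesis by (rule Cons.prems(1))
  next
    case False
    then obtain u c b v where "w = u @ (c, b) # (c, \<not> b) # v"
      by (rule Cons.IH[rotated])
    then have "l # w = (l # u) @ (c, b) # (c, \<not> b) # v" by simp
    then show ?thesis by (rule Cons.prems(1))
  qed
qed (simp add: reduced_def)

section \<open>Homomorphisms out of a presented group\<close>

definition presented_gen :: "'g set \<Rightarrow> ('g word \<times> 'g word) set \<Rightarrow> 'g \<Rightarrow> 'g word set" where
  "presented_gen X R x = word_class X R [(x, True)]"

lemma word_value_Nil [simp]: "word_value G f [] = \<one>\<^bsub>G\<^esub>"
  by (simp add: word_value_def)

lemma word_value_Cons [simp]:
  "word_value G f ((x, b) # w) =
    (if b then f x else inv\<^bsub>G\<^esub> (f x)) \<otimes>\<^bsub>G\<^esub> word_value G f w"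
  by (simp add: word_value_def)

context group
begin

lemma word_value_in_carrier:
  "w \<in> words X \<Longrightarrow> f ` X \<subseteq> carrier G \<Longrightarrow> word_value G f w \<in> carrier G"
  by (induction w) auto

lemma word_value_append_carrier:
  assumes "u \<in> words X" "v \<in> words X" "f ` X \<subseteq> carrier G"
  shows "word_value G f (u @ v) = word_value G f u \<otimes> word_value G f v"
  using assms
proof (induction u)
  case Nil
  then show ?case using word_value_in_carrier[of v X f] by simp
next
  case (Cons l u)
  then show ?case using word_value_in_carrier[of u X f] word_value_in_carrier[of v X f]
    by (cases l) (auto simp: m_assoc image_subset_iff)
qed

end

lemma (in group_hom) hom_word_value:
  "w \<in> words X \<Longrightarrow> f ` X \<subseteq> carrier G \<Longrightarrow>
    h (word_value G f w) = word_value H (\<lambda>x. h (f x)) w"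
proof (induction w)
  case (Cons l w)
  then show ?case using G.word_value_in_carrier[of w X f] by (cases l) auto
qed simp

lemma word_value_cong:
  "w \<in> words X \<Longrightarrow> (\<And>x. x \<in> X \<Longrightarrow> f x = g x) \<Longrightarrow> word_value G f w = word_value G g w"
  by (induction w) auto

lemma presented_gen_carrier:
  "x \<in> X \<Longrightarrow> presented_gen X R x \<in> carrier (presented_group X R)"
  by (simp add: presented_gen_def word_class_carrier)

lemma word_class_eq_word_value:
  "w \<in> words X \<Longrightarrow>
    word_value (presented_group X R) (presented_gen X R) w = word_class X R w"
proof (induction w)
  case Nil
  show ?case by (simp add: presented_group_one)
next
  case (Cons l w)
  interpret group "presented_group X R" by (rule group_presented_group)
  obtain x b where l: "l = (x, b)" by fastforce
  have x: "x \<in> X" and w: "w \<in> words X" using Cons.prems by (auto simp: l)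
  have "word_class X R [(x, False)] \<otimes>\<^bsub>presented_group X R\<^esub> presented_gen X R x =
      \<one>\<^bsub>presented_group X R\<^esub>"
    using x word_eq.cancel[OF x, of R False]
    by (simp add: presented_gen_def presented_group_mult presented_group_one word_class_eq_iff)
  then have "inv\<^bsub>presented_group X R\<^esub> presented_gen X R x = word_class X R [(x, False)]"
    using x by (intro inv_equality) (simp_all add: presented_gen_carrier word_class_carrier)
  then show ?case
    using Cons.IH[OF w] x w by (simp add: l presented_gen_def presented_group_mult)
qed

lemma presented_group_relation:
  assumes "(u, v) \<in> R" "u \<in> words X" "v \<in> words X"
  shows "word_value (presented_group X R) (presented_gen X R) u =
    word_value (presented_group X R) (presented_gen X R) v"
  using assms by (simp add: word_class_eq_word_value word_class_eq_iff word_eq.rel)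

lemma presented_group_generate:
  "generate (presented_group X R) (presented_gen X R ` X) = carrier (presented_group X R)"
proof
  interpret group "presented_group X R" by (rule group_presented_group)
  show "generate (presented_group X R) (presented_gen X R ` X) \<subseteq> carrier (presented_group X R)"
    by (rule generate_incl) (auto simp: presented_gen_carrier)
  have "word_value (presented_group X R) (presented_gen X R) w \<in>
      generate (presented_group X R) (presented_gen X R ` X)" if "w \<in> words X" for w
    using that
  proof (induction w)
    case (Cons l w)
    then show ?case by (cases l) (auto intro: generate.eng generate.incl generate.inv)
  qed (simp add: generate.one)
  then show "carrier (presented_group X R) \<subseteq> generate (presented_group X R) (presented_gen X R ` X)"
    by (auto simp: presented_group_carrier word_class_eq_word_value[symmetric])
qed

section \<open>The Coxeter presentation of the symmetric group\<close>

text \<open>The Coxeter relations present the symmetric group, so the subgroup generated by the \<open>r i\<close> is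
  mapped isomorphically to it. Having the homomorphism \<open>\<phi>\<close> to the symmetric group as a parameter
  allows the decompositions below to be stated in \<open>G\<close> only; their effect on permutations is read
  off by applying \<open>\<phi>\<close>.\<close>

locale coxeter_generators = group_hom G "sym_group n" \<phi>
  for G :: "('a, 'm) monoid_scheme" (structure) and n :: nat and \<phi> :: "'a \<Rightarrow> nat \<Rightarrow> nat" +
  fixes r :: "nat \<Rightarrow> 'a"
  assumes r_closed: "i \<in> {1..<n} \<Longrightarrow> r i \<in> carrier G"
    and r_perm: "i \<in> {1..<n} \<Longrightarrow> \<phi> (r i) = transpose i (Suc i)"
    and r_square: "i \<in> {1..<n} \<Longrightarrow> r i \<otimes> r i = \<one>"
    and r_braid: "1 \<le> i \<Longrightarrow> Suc i < n \<Longrightarrow>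
      r i \<otimes> r (Suc i) \<otimes> r i = r (Suc i) \<otimes> r i \<otimes> r (Suc i)"
    and r_comm: "1 \<le> i \<Longrightarrow> Suc i < j \<Longrightarrow> j < n \<Longrightarrow> r i \<otimes> r j = r j \<otimes> r i"
begin

definition r_prod :: "nat list \<Rightarrow> 'a" where
  "r_prod u = foldr (\<lambda>i x. r i \<otimes> x) u \<one>"

lemma r_prod_Nil [simp]: "r_prod [] = \<one>"
  by (simp add: r_prod_def)

lemma r_prod_Cons [simp]: "r_prod (i # u) = r i \<otimes> r_prod u"
  by (simp add: r_prod_def)

lemma r_inv: "i \<in> {1..<n} \<Longrightarrow> inv (r i) = r i"
  using r_closed r_square by (simp add: G.inv_equality)

lemma r_prod_closed: "set u \<subseteq> {1..<n} \<Longrightarrow> r_prod u \<in> carrier G"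
  by (induction u) (auto simp: r_closed)

lemma r_prod_append:
  "set u \<subseteq> {1..<n} \<Longrightarrow> set v \<subseteq> {1..<n} \<Longrightarrow> r_prod (u @ v) = r_prod u \<otimes> r_prod v"
  by (induction u) (auto simp: r_closed r_prod_closed G.m_assoc)

lemma r_prod_rev: "set u \<subseteq> {1..<n} \<Longrightarrow> r_prod (rev u) = inv (r_prod u)"
  by (induction u) (auto simp: r_closed r_prod_closed r_prod_append G.inv_mult_group r_inv)

lemma r_prod_commute:
  assumes "a \<in> carrier G" "set u \<subseteq> {1..<n}" "\<And>i. i \<in> set u \<Longrightarrow> a \<otimes> r i = r i \<otimes> a"
  shows "a \<otimes> r_prod u = r_prod u \<otimes> a"
  using assms(2,3)
proof (induction u)
  case (Cons i u)
  then have *: "r i \<in> carrier G" "r_prod u \<in> carrier G" "a \<otimes> r i = r i \<otimes> a"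
      "a \<otimes> r_prod u = r_prod u \<otimes> a"
    by (auto simp: r_closed r_prod_closed)
  then show ?case using assms(1) by (simp add: G.m_assoc[symmetric]) (simp add: G.m_assoc)
qed (simp add: assms(1))

lemma r_prod_perm_fix:
  assumes "set u \<subseteq> {1..<n}" "\<And>i. i \<in> set u \<Longrightarrow> p \<noteq> i \<and> p \<noteq> Suc i"
  shows "\<phi> (r_prod u) p = p"
  using assms
proof (induction u)
  case (Cons i u)
  then show ?case
    by (simp add: r_closed r_prod_closed sym_group_mult r_perm)
qed (simp add: sym_group_one)

text \<open>The descending product from \<open>m\<close> to \<open>k\<close> is the coset representative that carries the point
  \<open>k\<close> to \<open>m + 1\<close>; for \<open>k = m + 1\<close> it is empty.\<close>

definition descent :: "nat \<Rightarrow> nat \<Rightarrow> nat list" where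
  "descent m k = rev [k..<Suc m]"

lemma set_descent [simp]: "set (descent m k) = {k..m}"
  by (auto simp: descent_def)

lemma descent_Suc: "k \<le> m \<Longrightarrow> descent m k = descent m (Suc k) @ [k]"
  by (simp add: descent_def upt_conv_Cons)

lemma descent_split: "k \<le> j \<Longrightarrow> j \<le> m \<Longrightarrow> descent m k = descent m (Suc j) @ descent j k"
  unfolding descent_def using upt_add_eq_append[of k "Suc j" "m - j"] by simp

lemma r_prod_descent:
  assumes "1 \<le> k" "k \<le> m" "m < n"
  shows "r_prod (descent m k) = r_prod (descent m (Suc k)) \<otimes> r k"
proof -
  have "set (descent m (Suc k)) \<subseteq> {1..<n}" "set [k] \<subseteq> {1..<n}" "r k \<in> carrier G"
    using assms by (auto intro: r_closed)
  then show ?thesis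
    using assms(2) by (subst descent_Suc) (simp_all only: r_prod_append, simp)
qed

lemma descent_perm:
  assumes "1 \<le> k" "k \<le> Suc m" "m < n"
  shows "\<phi> (r_prod (descent m k)) k = Suc m"
  using assms(2,1)
proof (induction k rule: inc_induct)
  case base
  then show ?case by (simp add: descent_def sym_group_one)
next
  case (step k)
  have "r_prod (descent m (Suc k)) \<in> carrier G" "r k \<in> carrier G"
    using step.hyps step.prems assms(3) by (auto intro!: r_prod_closed r_closed)
  then show ?case using step assms(3)
    by (simp add: r_prod_descent sym_group_mult r_perm)
qed

text \<open>The letters of the descent above \<open>j\<close> and below \<open>j - 1\<close> commute with \<open>r (j - 1)\<close> and \<open>r j\<close>
  respectively, so the braid relation for \<open>j - 1\<close> and \<open>j\<close> can be applied in the middle.\<close>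

lemma descent_absorb:
  assumes k: "1 \<le> k" "k < j" "j \<le> m" and m: "m < n"
  shows "r_prod (descent m k) \<otimes> r j = r (j - 1) \<otimes> r_prod (descent m k)"
proof -
  define i where "i = j - 1"
  have j: "j = Suc i" and i: "k \<le> i" using k by (auto simp: i_def)
  define a where "a = r_prod (descent m (Suc j))"
  define b where "b = r_prod (rev [k..<i])"
  have "descent m k = descent m (Suc j) @ [j, i] @ rev [k..<i]"
    using k i by (simp add: descent_split[of k j m] j) (simp add: descent_def)
  then have split: "r_prod (descent m k) = a \<otimes> (r j \<otimes> (r i \<otimes> b))"
    using k m i by (subst \<open>descent m k = _\<close>, subst r_prod_append) (auto simp: a_def b_def j)
  have cl: "a \<in> carrier G" "b \<in> carrier G" "r i \<in> carrier G" "r j \<in> carrier G"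
    using k m i unfolding a_def b_def by (auto intro!: r_prod_closed r_closed simp: j)
  have b: "r j \<otimes> b = b \<otimes> r j"
    unfolding b_def using k m cl(4) j by (intro r_prod_commute) (auto intro!: r_comm[symmetric])
  have a: "r i \<otimes> a = a \<otimes> r i"
    unfolding a_def using k m cl(3) i j by (intro r_prod_commute) (auto intro!: r_comm)
  have br: "r i \<otimes> (r j \<otimes> r i) = r j \<otimes> (r i \<otimes> r j)"
    using r_braid[of i] k i m cl by (simp add: j G.m_assoc)
  have "r_prod (descent m k) \<otimes> r j = a \<otimes> (r j \<otimes> (r i \<otimes> (b \<otimes> r j)))"
    using cl by (simp add: split G.m_assoc)
  also have "\<dots> = a \<otimes> (r j \<otimes> (r i \<otimes> r j)) \<otimes> b"
    using cl by (simp add: b[symmetric] G.m_assoc)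
  also have "\<dots> = (a \<otimes> r i) \<otimes> (r j \<otimes> (r i \<otimes> b))"
    using cl by (simp add: br[symmetric] G.m_assoc)
  also have "\<dots> = r i \<otimes> r_prod (descent m k)"
    using cl by (simp add: a[symmetric] split G.m_assoc)
  finally show ?thesis by (simp add: j)
qed

text \<open>Right multiplication by a generator permutes the descents up to a factor from the smaller
  group, so the descents represent all its right cosets.\<close>

lemma r_prod_peel:
  assumes "set u \<subseteq> {1..m}" "m < n"
  shows "\<exists>v k. set v \<subseteq> {1..<m} \<and> k \<in> {1..Suc m} \<and>
    r_prod u = r_prod v \<otimes> r_prod (descent m k)"
  using assms(1)
proof (induction u rule: rev_induct)
  case Nil
  show ?case by (rule exI[of _ "[]"], rule exI[of _ "Suc m"]) (simp add: descent_def)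
next
  case (snoc j u)
  then obtain v k where vk: "set v \<subseteq> {1..<m}" "k \<in> {1..Suc m}"
    "r_prod u = r_prod v \<otimes> r_prod (descent m k)"
    by auto
  have j: "1 \<le> j" "j \<le> m" using snoc.prems by auto
  have V: "set v \<subseteq> {1..<n}" using vk(1) assms(2) by auto
  have cl: "r_prod v \<in> carrier G" "r_prod (descent m k) \<in> carrier G" "r j \<in> carrier G"
    using V vk(2) j assms(2) by (auto intro!: r_prod_closed r_closed)
  have "r_prod (u @ [j]) = r_prod u \<otimes> r j"
    using snoc.prems assms(2) cl by (subst r_prod_append) auto
  also have "\<dots> = r_prod v \<otimes> (r_prod (descent m k) \<otimes> r j)"
    using cl by (simp add: vk G.m_assoc)
  finally have eq: "r_prod (u @ [j]) = r_prod v \<otimes> (r_prod (descent m k) \<otimes> r j)" .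
  have move: ?case if i: "i \<in> {1..<m}" and
    "r_prod (descent m k) \<otimes> r j = r i \<otimes> r_prod (descent m k)" for i
  proof -
    have "r i \<in> carrier G" using i assms(2) by (auto intro: r_closed)
    then have "r_prod (u @ [j]) = r_prod (v @ [i]) \<otimes> r_prod (descent m k)"
      using that V i assms(2) cl by (simp add: eq r_prod_append G.m_assoc)
    then show ?thesis using vk i by (intro exI[of _ "v @ [i]"] exI[of _ k]) auto
  qed
  consider "Suc j < k" | "Suc j = k" | "j = k" | "k < j" by linarith
  then show ?case
  proof cases
    case 1
    have "r j \<otimes> r_prod (descent m k) = r_prod (descent m k) \<otimes> r j"
      using 1 j vk(2) assms(2) cl(3) by (intro r_prod_commute) (auto intro: r_comm)
    then show ?thesis using 1 vk(2) j by (intro move) auto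
  next
    case 2
    then have "r_prod (descent m k) \<otimes> r j = r_prod (descent m j)"
      using j assms(2) by (simp add: r_prod_descent)
    then show ?thesis using eq vk j by (intro exI[of _ v] exI[of _ j]) auto
  next
    case 3
    have D: "r_prod (descent m (Suc k)) \<in> carrier G"
      using j assms(2) by (auto intro!: r_prod_closed)
    have "r_prod (descent m k) = r_prod (descent m (Suc k)) \<otimes> r k"
      using 3 j assms(2) by (simp add: r_prod_descent)
    then have "r_prod (descent m k) \<otimes> r j = r_prod (descent m (Suc k))"
      using 3 j assms(2) cl D by (simp add: G.m_assoc r_square)
    then show ?thesis using eq vk j 3 by (intro exI[of _ v] exI[of _ "Suc k"]) auto
  next
    case 4
    then show ?thesis using j vk(2) assms(2) by (intro move[of "j - 1"] descent_absorb) auto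
  qed
qed

text \<open>If a product of \<open>r 1, \<dots>, r m\<close> has trivial image, its image fixes \<open>m + 1\<close>; hence the descent
  in its decomposition is empty and \<open>r m\<close> can be eliminated.\<close>

lemma r_prod_eq_one:
  assumes "set u \<subseteq> {1..m}" "m < n" "\<phi> (r_prod u) = id"
  shows "r_prod u = \<one>"
  using assms
proof (induction m arbitrary: u)
  case (Suc m)
  obtain v k where vk: "set v \<subseteq> {1..<Suc m}" "k \<in> {1..Suc (Suc m)}"
    "r_prod u = r_prod v \<otimes> r_prod (descent (Suc m) k)"
    using r_prod_peel[OF Suc.prems(1,2)] by blast
  have cl: "r_prod v \<in> carrier G" "r_prod (descent (Suc m) k) \<in> carrier G"
    using vk Suc.prems(2) by (auto intro!: r_prod_closed)
  have "\<phi> (r_prod v) (Suc (Suc m)) = Suc (Suc m)"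
    using vk(1) Suc.prems(2) by (intro r_prod_perm_fix) auto
  then have "\<phi> (r_prod u) k = Suc (Suc m)"
    using vk Suc.prems(2) cl descent_perm[of k "Suc m"] by (simp add: sym_group_mult)
  then have "k = Suc (Suc m)" using Suc.prems(3) by simp
  then have "r_prod u = r_prod v"
    using vk(3) cl by (simp add: descent_def)
  then show ?case
    using Suc.IH[of v] Suc.prems vk(1) by (simp add: atLeastLessThanSuc_atLeastAtMost)
qed simp

text \<open>If \<open>p\<close> carries \<open>m\<close> to \<open>k\<close>, the product \<open>r m \<dots> r (k - 1)\<close> carries \<open>k\<close> back to \<open>m\<close>, which leaves a
  permutation of \<open>m + 1, \<dots>, n\<close>. The lower bound \<open>m\<close> matters later: permutations that fix small
  points need only generators with large index.\<close>

lemma r_prod_onto: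
  assumes "p permutes {m..n}" "1 \<le> m"
  shows "\<exists>u. set u \<subseteq> {m..<n} \<and> \<phi> (r_prod u) = p"
  using assms
proof (induction "n - m" arbitrary: m p)
  case 0
  then have "p = id"
    using permutes_superset[of p "{m..n}" "{}"]
    by (cases "m = n") (auto simp: permutes_sing)
  then show ?case by (intro exI[of _ "[]"]) (simp add: sym_group_one)
next
  case (Suc d)
  define k where "k = p m"
  have mn: "m < n" using Suc.hyps(2) by simp
  have k: "m \<le> k" "k \<le> n"
    using permutes_in_image[OF Suc.prems(1), of m] mn by (auto simp: k_def)
  define D where "D = [m..<k]"
  have D: "set D \<subseteq> {m..<n}" "set D \<subseteq> {1..<n}" using k Suc.prems(2) by (auto simp: D_def)
  have Dm: "\<phi> (r_prod [m..<k]) k = m" if "m \<le> k" "k \<le> n" for k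
    using that
  proof (induction k rule: dec_induct)
    case base
    show ?case by (simp add: sym_group_one)
  next
    case (step k)
    then show ?case using Suc.prems(2)
      by (simp add: r_prod_append r_closed r_prod_closed sym_group_mult r_perm)
  qed
  have Dp: "\<phi> (r_prod D) permutes {m..n}"
    using D
  proof (induction "D")
    case Nil
    show ?case by (simp add: sym_group_one permutes_def)
  next
    case (Cons i w)
    then have "transpose i (Suc i) permutes {m..n}"
      by (intro permutes_swap_id) auto
    moreover have "\<phi> (r_prod (i # w)) = transpose i (Suc i) \<circ> \<phi> (r_prod w)"
      using Cons.prems by (simp add: r_closed r_prod_closed sym_group_mult r_perm)
    moreover have "\<phi> (r_prod w) permutes {m..n}" using Cons by simp
    ultimately show ?case by (metis permutes_compose)
  qed
  define q where "q = \<phi> (r_prod D) \<circ> p"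
  have "q permutes {m..n}"
    unfolding q_def using Suc.prems(1) Dp by (rule permutes_compose)
  moreover have "q m = m"
    using Dm[OF k] by (simp add: q_def k_def[symmetric] D_def)
  ultimately have "q permutes {Suc m..n}"
    using permutes_superset[of q "{m..n}" "{Suc m..n}"] by (force simp: le_less_Suc_eq not_le)
  then obtain u where u: "set u \<subseteq> {Suc m..<n}" "\<phi> (r_prod u) = q"
    using Suc.hyps(1)[of "Suc m" q] Suc.hyps(2) by fastforce
  have U: "set u \<subseteq> {1..<n}" using u(1) by auto
  have DD: "\<phi> (r_prod (rev D)) \<circ> \<phi> (r_prod D) = id"
    using permutes_inv_o(2)[OF Dp] D by (simp add: r_prod_rev r_prod_closed)
  have "\<phi> (r_prod (rev D @ u)) = \<phi> (r_prod (rev D)) \<circ> q"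
    using D U u(2) by (simp add: r_prod_append r_prod_closed sym_group_mult)
  also have "\<dots> = p"
    using DD by (simp add: q_def o_assoc)
  finally show ?case using D(1) u(1) by (intro exI[of _ "rev D @ u"]) auto
qed

text \<open>The subgroup generated by the \<open>r i\<close>; since these are involutions, products of generators
  without inverses exhaust it.\<close>

definition perm_part :: "'a set" where
  "perm_part = r_prod ` {u. set u \<subseteq> {1..<n}}"

lemma perm_part_carrier: "x \<in> perm_part \<Longrightarrow> x \<in> carrier G"
  by (auto simp: perm_part_def r_prod_closed)

lemma perm_part_one: "\<one> \<in> perm_part"
  unfolding perm_part_def by (rule image_eqI[of _ _ "[]"]) auto

lemma perm_part_r: "i \<in> {1..<n} \<Longrightarrow> r i \<in> perm_part"
  unfolding perm_part_def by (rule image_eqI[of _ _ "[i]"]) (auto simp: r_closed)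

lemma perm_part_mult: "x \<in> perm_part \<Longrightarrow> y \<in> perm_part \<Longrightarrow> x \<otimes> y \<in> perm_part"
  unfolding perm_part_def by (auto simp: r_prod_append[symmetric])

lemma perm_part_inv: "x \<in> perm_part \<Longrightarrow> inv x \<in> perm_part"
  unfolding perm_part_def by (auto simp: r_prod_rev[symmetric])

lemma perm_part_eq_one:
  assumes "x \<in> perm_part" "\<phi> x = id"
  shows "x = \<one>"
proof -
  obtain u where u: "x = r_prod u" "set u \<subseteq> {1..<n}"
    using assms(1) by (auto simp: perm_part_def)
  show ?thesis
  proof (cases "n = 0")
    case False
    then show ?thesis using r_prod_eq_one[of u "n - 1"] u assms(2) by fastforce
  qed (use u in simp)
qed

lemma perm_part_inj:
  assumes "x \<in> perm_part" "y \<in> perm_part" "\<phi> x = \<phi> y"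
  shows "x = y"
proof -
  have cl: "x \<in> carrier G" "y \<in> carrier G" using assms by (simp_all add: perm_part_carrier)
  then have "\<phi> (x \<otimes> inv y) = id"
    using assms(3) by (simp add: sym_group_one del: sym_group_inv_equality)
  then have "x \<otimes> inv y = \<one>"
    using assms by (intro perm_part_eq_one) (simp_all add: perm_part_mult perm_part_inv)
  then show ?thesis
    using cl by (metis G.inv_equality G.inv_inv G.inv_closed)
qed

lemma perm_part_onto:
  assumes "p permutes {1..n}"
  shows "\<exists>x\<in>perm_part. \<phi> x = p"
  using r_prod_onto[OF assms] by (auto simp: perm_part_def)

end

section \<open>Pure generators and the normal form\<close>

text \<open>The algebraic core. Here \<open>a, b, c\<close> stand for \<open>\<lambda>\<^sub>1\<^sub>2, \<lambda>\<^sub>2\<^sub>3, \<lambda>\<^sub>1\<^sub>3\<close> and \<open>r, s\<close> for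
  \<open>\<rho>\<^sub>1, \<rho>\<^sub>2\<close>, so that \<open>a r\<close> and \<open>b s\<close> are \<open>\<sigma>\<^sub>1\<close> and \<open>\<sigma>\<^sub>2\<close>. Once \<open>r\<close> and \<open>s\<close> are moved to the
  right, both sides of each relation end in the same factor \<open>r s r\<close>. The two mixed
  relations become the first two commutation rules, and with their help the braid relation
  becomes the third one.\<close>

lemma (in group) three_strand_commute:
  assumes cl: "a \<in> carrier G" "b \<in> carrier G" "c \<in> carrier G" "r \<in> carrier G" "s \<in> carrier G"
    and rb: "r \<otimes> b = c \<otimes> r" and sa: "s \<otimes> a = c \<otimes> s"
    and rc: "r \<otimes> c = b \<otimes> r" and sc: "s \<otimes> c = a \<otimes> s"
    and rs: "r \<otimes> s \<otimes> r = s \<otimes> r \<otimes> s"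
    and f1: "r \<otimes> (b \<otimes> s) \<otimes> (a \<otimes> r) = (b \<otimes> s) \<otimes> (a \<otimes> r) \<otimes> s"
    and f2: "s \<otimes> (a \<otimes> r) \<otimes> (b \<otimes> s) = (a \<otimes> r) \<otimes> (b \<otimes> s) \<otimes> r"
    and br: "(a \<otimes> r) \<otimes> (b \<otimes> s) \<otimes> (a \<otimes> r) = (b \<otimes> s) \<otimes> (a \<otimes> r) \<otimes> (b \<otimes> s)"
  shows "c \<otimes> b = b \<otimes> c" "c \<otimes> a = a \<otimes> c" "a \<otimes> b = b \<otimes> a"
proof -
  let ?d = "r \<otimes> (s \<otimes> r)"
  have d: "?d \<in> carrier G" using cl by simp
  \<comment> \<open>rules that move \<open>r\<close> and \<open>s\<close> to the right\<close>
  have push: "r \<otimes> (b \<otimes> z) = c \<otimes> (r \<otimes> z)" "s \<otimes> (a \<otimes> z) = c \<otimes> (s \<otimes> z)"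
    "r \<otimes> (c \<otimes> z) = b \<otimes> (r \<otimes> z)" "s \<otimes> (c \<otimes> z) = a \<otimes> (s \<otimes> z)" if "z \<in> carrier G" for z
    using cl that rb sa rc sc by (simp_all add: m_assoc[symmetric])
  have rs': "s \<otimes> (r \<otimes> s) = ?d" using cl rs by (simp add: m_assoc)
  have "c \<otimes> b \<otimes> ?d = b \<otimes> c \<otimes> ?d"
    using f1 cl by (simp add: m_assoc push rb sa rc sc rs')
  then show cb: "c \<otimes> b = b \<otimes> c" using cl d by simp
  have "c \<otimes> a \<otimes> ?d = a \<otimes> c \<otimes> ?d"
    using f2 cl by (simp add: m_assoc push rb sa rc sc rs')
  then show ca: "c \<otimes> a = a \<otimes> c" using cl d by simp
  have "a \<otimes> (c \<otimes> b) \<otimes> ?d = b \<otimes> (c \<otimes> a) \<otimes> ?d"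
    using br cl by (simp add: m_assoc push rb sa rc sc rs')
  then have "a \<otimes> (c \<otimes> b) = b \<otimes> (c \<otimes> a)" using cl d by simp
  then have "a \<otimes> b \<otimes> c = b \<otimes> a \<otimes> c"
    using cl by (simp add: cb ca m_assoc)
  then show "a \<otimes> b = b \<otimes> a" using cl by simp
qed

text \<open>The group is a separate parameter only to make the structure notation available.\<close>

locale unrestricted_virtual_braid =
  fixes n :: nat and G :: "uvb_gen word set monoid" (structure)
  assumes two_le: "2 \<le> n" and G_eq: "G = UVB n"
begin

definition gen :: "uvb_gen \<Rightarrow> uvb_gen word set" where
  "gen = presented_gen (uvb_gens n) (uvb_rels n)"

abbreviation \<sigma> :: "nat \<Rightarrow> uvb_gen word set" where "\<sigma> i \<equiv> gen (Sig i)"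
abbreviation \<rho> :: "nat \<Rightarrow> uvb_gen word set" where "\<rho> i \<equiv> gen (Rho i)"
abbreviation perm :: "uvb_gen word set \<Rightarrow> nat \<Rightarrow> nat" where "perm \<equiv> uvb_perm n"

lemma G_presented: "G = presented_group (uvb_gens n) (uvb_rels n)"
  by (simp add: G_eq UVB_def)

lemma gens_iff [simp]: "Sig i \<in> uvb_gens n \<longleftrightarrow> i \<in> {1..<n}" "Rho i \<in> uvb_gens n \<longleftrightarrow> i \<in> {1..<n}"
  by (auto simp: uvb_gens_def)

lemma gen_closed: "x \<in> uvb_gens n \<Longrightarrow> gen x \<in> carrier G"
  by (simp add: gen_def G_presented presented_gen_carrier)

lemma \<sigma>_closed: "i \<in> {1..<n} \<Longrightarrow> \<sigma> i \<in> carrier G"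
  and \<rho>_closed: "i \<in> {1..<n} \<Longrightarrow> \<rho> i \<in> carrier G"
  by (simp_all add: gen_closed)

lemma gen_generate: "generate G (gen ` uvb_gens n) = carrier G"
  unfolding G_presented gen_def by (rule presented_group_generate)

lemma perm_gen: "x \<in> uvb_gens n \<Longrightarrow> perm (gen x) = gen_perm x"
  by (simp add: gen_def presented_gen_def uvb_perm_gen)

lemma gen_relation: "(u, v) \<in> uvb_rels n \<Longrightarrow> word_value G gen u = word_value G gen v"
  using uvb_rels_words[of u v n] by (simp add: G_presented gen_def presented_group_relation)

lemma group_G: "group G"
  by (simp add: G_eq group_UVB)

lemma farI: "1 \<le> i \<Longrightarrow> Suc i < j \<Longrightarrow> j < n \<Longrightarrow> far n i j" "1 \<le> i \<Longrightarrow> Suc i < j \<Longrightarrow> j < n \<Longrightarrow> far n j i"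
  by (auto simp: far_def)

context
begin

interpretation group G by (rule group_G)

lemma \<rho>_square: "i \<in> {1..<n} \<Longrightarrow> \<rho> i \<otimes> \<rho> i = \<one>"
  using gen_relation[of "[rh i, rh i]" "[]"] \<rho>_closed[of i]
  by (auto simp: uvb_rels_def)

lemma far_commute:
  assumes "1 \<le> i" "Suc i < j" "j < n"
  shows "\<sigma> i \<otimes> \<sigma> j = \<sigma> j \<otimes> \<sigma> i" (is ?P1)
    "\<rho> i \<otimes> \<rho> j = \<rho> j \<otimes> \<rho> i" (is ?P2)
    "\<sigma> i \<otimes> \<rho> j = \<rho> j \<otimes> \<sigma> i" (is ?P3)
    "\<rho> i \<otimes> \<sigma> j = \<sigma> j \<otimes> \<rho> i" (is ?P4)
proof -
  have cl: "\<sigma> i \<in> carrier G" "\<sigma> j \<in> carrier G" "\<rho> i \<in> carrier G" "\<rho> j \<in> carrier G"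
    using assms by (auto intro!: gen_closed)
  have "([sg i, sg j], [sg j, sg i]) \<in> uvb_rels n" "([rh i, rh j], [rh j, rh i]) \<in> uvb_rels n"
    "([sg i, rh j], [rh j, sg i]) \<in> uvb_rels n" "([sg j, rh i], [rh i, sg j]) \<in> uvb_rels n"
    using farI[OF assms] by (simp_all add: uvb_rels_def)
  from this[THEN gen_relation] cl
  show ?P1 ?P2 ?P3 ?P4
    by simp_all
qed

lemma three_strand_relations:
  assumes "1 \<le> i" "Suc i < n"
  shows "\<sigma> i \<otimes> \<sigma> (Suc i) \<otimes> \<sigma> i = \<sigma> (Suc i) \<otimes> \<sigma> i \<otimes> \<sigma> (Suc i)" (is ?P1)
    "\<rho> i \<otimes> \<rho> (Suc i) \<otimes> \<rho> i = \<rho> (Suc i) \<otimes> \<rho> i \<otimes> \<rho> (Suc i)" (is ?P2)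
    "\<sigma> i \<otimes> \<rho> (Suc i) \<otimes> \<rho> i = \<rho> (Suc i) \<otimes> \<rho> i \<otimes> \<sigma> (Suc i)" (is ?P3)
    "\<rho> i \<otimes> \<sigma> (Suc i) \<otimes> \<sigma> i = \<sigma> (Suc i) \<otimes> \<sigma> i \<otimes> \<rho> (Suc i)" (is ?P4)
    "\<rho> (Suc i) \<otimes> \<sigma> i \<otimes> \<sigma> (Suc i) = \<sigma> i \<otimes> \<sigma> (Suc i) \<otimes> \<rho> i" (is ?P5)
proof -
  let ?j = "i + 1"
  have cl: "\<sigma> i \<in> carrier G" "\<sigma> (Suc i) \<in> carrier G" "\<rho> i \<in> carrier G" "\<rho> (Suc i) \<in> carrier G"
    using assms by (auto intro!: gen_closed)
  have i: "i \<in> {1..n - 2}" using assms by auto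
  have "([sg i, sg ?j, sg i], [sg ?j, sg i, sg ?j]) \<in> uvb_rels n"
    "([rh i, rh ?j, rh i], [rh ?j, rh i, rh ?j]) \<in> uvb_rels n"
    "([sg i, rh ?j, rh i], [rh ?j, rh i, sg ?j]) \<in> uvb_rels n"
    "([rh i, sg ?j, sg i], [sg ?j, sg i, rh ?j]) \<in> uvb_rels n"
    "([rh ?j, sg i, sg ?j], [sg i, sg ?j, rh i]) \<in> uvb_rels n"
    using i by (simp_all add: uvb_rels_def)
  from this[THEN gen_relation] cl
  show ?P1 ?P2 ?P3 ?P4 ?P5
    by (simp_all add: m_assoc)
qed

end

sublocale coxeter_generators G n "uvb_perm n" \<rho>
proof (intro coxeter_generators.intro coxeter_generators_axioms.intro)
  show "group_hom G (sym_group n) perm"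
    using uvb_perm_hom[of n] group_G
    by (simp add: group_hom_def group_hom_axioms_def sym_group_is_group G_eq)
  show "perm (\<rho> i) = transpose i (Suc i)" if "i \<in> {1..<n}" for i
    using that by (simp add: perm_gen)
qed (rule \<rho>_closed \<rho>_square three_strand_relations(2) far_commute(2); assumption)+

lemma perm_permutes: "x \<in> carrier G \<Longrightarrow> perm x permutes {1..n}"
  using hom_closed[of x] by (simp only: sym_group_carrier)

lemma perm_in_range: "x \<in> carrier G \<Longrightarrow> perm x i \<in> {1..n} \<longleftrightarrow> i \<in> {1..n}"
  by (rule permutes_in_image[OF perm_permutes])

lemma perm_eq_iff: "x \<in> carrier G \<Longrightarrow> perm x i = perm x j \<longleftrightarrow> i = j"
  by (rule inj_eq[OF permutes_inj[OF perm_permutes]])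

lemma perm_mult: "x \<in> carrier G \<Longrightarrow> y \<in> carrier G \<Longrightarrow> perm (x \<otimes> y) i = perm x (perm y i)"
  by (simp only: hom_mult sym_group_mult o_apply)

lemma perm_one: "perm \<one> i = i"
  by (simp only: hom_one sym_group_one id_apply)

lemma perm_inv_cancel:
  assumes "x \<in> carrier G"
  shows "perm (inv x) (perm x i) = i" "perm x (perm (inv x) i) = i"
  using perm_mult[of "inv x" x i] perm_mult[of x "inv x" i] assms
  by (simp_all only: G.inv_closed G.l_inv G.r_inv perm_one)

lemma perm_part_multi_transitive:
  assumes "distinct xs" "set xs \<subseteq> {1..n}"
  obtains x where "x \<in> perm_part" "\<And>t. t < length xs \<Longrightarrow> perm x (Suc t) = xs ! t"
proof -
  define E where "E = {(Suc t, xs ! t) | t. t < length xs}"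
  have "length xs \<le> n"
    using card_mono[OF _ assms(2)] distinct_card[OF assms(1)] by simp
  then have "E \<subseteq> {1..n} \<times> {1..n}"
    using assms(2) by (auto simp: E_def dest: nth_mem)
  moreover have "single_valued E"
    by (auto simp: E_def single_valued_def)
  moreover have "single_valued (E\<inverse>)"
    using assms(1) by (auto simp: E_def single_valued_def nth_eq_iff_index_eq)
  ultimately obtain p where p: "p permutes {1..n}" "\<And>a b. (a, b) \<in> E \<Longrightarrow> p a = b"
    using partial_injection_extends_to_permutation[of "{1..n}" E] by blast
  obtain x where x: "x \<in> perm_part" "perm x = p"
    using perm_part_onto[OF p(1)] by blast
  show ?thesis
    by (rule that[OF x(1)]) (auto simp: x(2) E_def intro!: p(2))
qed

definition pairs :: "(nat \<times> nat) set" where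
  "pairs = {(i, j). i \<in> {1..n} \<and> j \<in> {1..n} \<and> i \<noteq> j}"

definition base :: "uvb_gen word set" where
  "base = \<sigma> 1 \<otimes> \<rho> 1"

text \<open>The element \<open>\<lambda>\<^sub>i\<^sub>j\<close>. The choice is immaterial by \<open>pure_gen_eq\<close>, because elements of the permutation
  part that fix \<open>1\<close> and \<open>2\<close> commute with the base element.\<close>

definition pure_gen :: "nat \<times> nat \<Rightarrow> uvb_gen word set" where
  "pure_gen c = (SOME y. \<exists>x\<in>perm_part. perm x 1 = fst c \<and> perm x 2 = snd c \<and> y = x \<otimes> base \<otimes> inv x)"

lemma base_closed: "base \<in> carrier G"
  using two_le by (auto simp: base_def intro!: gen_closed)

text \<open>A permutation that fixes \<open>1\<close> and \<open>2\<close> permutes \<open>3, \<dots>, n\<close>, so the corresponding element is a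
  product of virtual generators that commute with \<open>\<sigma> 1\<close> and \<open>\<rho> 1\<close>.\<close>

lemma perm_part_fixing_commutes_base:
  assumes x: "x \<in> perm_part" and fixed: "perm x 1 = 1" "perm x 2 = 2"
  shows "x \<otimes> base = base \<otimes> x"
proof -
  have "perm x permutes {1..n}"
    by (rule perm_permutes[OF perm_part_carrier[OF x]])
  then have "perm x permutes {3..n}"
  proof (rule permutes_superset)
    show "perm x i = i" if "i \<in> {1..n} - {3..n}" for i
    proof -
      have "i = 1 \<or> i = 2" using that by auto
      then show ?thesis using fixed by auto
    qed
  qed
  then obtain u where u: "set u \<subseteq> {3..<n}" "perm (r_prod u) = perm x"
    using r_prod_onto[of "perm x" 3] by auto
  have u1: "set u \<subseteq> {1..<n}" using u(1) by auto
  have "x = r_prod u"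
    using x u(2) u1 by (intro perm_part_inj) (auto simp: perm_part_def)
  have "base \<otimes> r_prod u = r_prod u \<otimes> base"
  proof (rule r_prod_commute[OF base_closed u1])
    fix i assume "i \<in> set u"
    then have i: "Suc 1 < i" "i < n" using u(1) by auto
    have cl: "\<sigma> 1 \<in> carrier G" "\<rho> 1 \<in> carrier G" "\<rho> i \<in> carrier G"
      using i by (auto intro!: gen_closed)
    have "base \<otimes> \<rho> i = \<sigma> 1 \<otimes> (\<rho> i \<otimes> \<rho> 1)"
      using cl far_commute(2)[of 1 i] i by (simp add: base_def G.m_assoc)
    also have "\<dots> = \<rho> i \<otimes> base"
      using cl far_commute(3)[of 1 i] i by (simp add: base_def G.m_assoc[symmetric])
    finally show "base \<otimes> \<rho> i = \<rho> i \<otimes> base" .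
  qed
  then show ?thesis by (simp add: \<open>x = r_prod u\<close>)
qed

lemma pure_gen_eq:
  assumes x: "x \<in> perm_part"
  shows "pure_gen (perm x 1, perm x 2) = x \<otimes> base \<otimes> inv x"
  unfolding pure_gen_def
proof (rule some_equality)
  fix y assume "\<exists>z\<in>perm_part. perm z 1 = fst (perm x 1, perm x 2) \<and>
    perm z 2 = snd (perm x 1, perm x 2) \<and> y = z \<otimes> base \<otimes> inv z"
  then obtain z where z: "z \<in> perm_part" "perm z 1 = perm x 1" "perm z 2 = perm x 2"
    and y: "y = z \<otimes> base \<otimes> inv z" by auto
  have cl: "x \<in> carrier G" "z \<in> carrier G" "base \<in> carrier G"
    using x z by (simp_all add: perm_part_carrier base_closed)
  have "(inv x \<otimes> z) \<otimes> base = base \<otimes> (inv x \<otimes> z)"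
    using x z cl perm_inv_cancel(1)[of x 1] perm_inv_cancel(1)[of x 2]
    by (intro perm_part_fixing_commutes_base)
      (simp_all add: perm_part_mult perm_part_inv perm_mult del: hom_mult)
  then have "x \<otimes> ((inv x \<otimes> z) \<otimes> base) \<otimes> inv z = x \<otimes> (base \<otimes> (inv x \<otimes> z)) \<otimes> inv z"
    by simp
  then show "y = x \<otimes> base \<otimes> inv x"
    using cl by (simp add: y G.m_assoc G.inv_solve_left')
qed (use x in auto)

lemma pairsE:
  assumes "c \<in> pairs"
  obtains x where "x \<in> perm_part" "c = (perm x 1, perm x 2)"
proof -
  obtain i j where c: "c = (i, j)" by fastforce
  obtain x where "x \<in> perm_part" "\<And>t. t < length [i, j] \<Longrightarrow> perm x (Suc t) = [i, j] ! t"
    using assms by (elim perm_part_multi_transitive[of "[i, j]", rotated 2]) (auto simp: pairs_def c)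
  from this(1) this(2)[of 0] this(2)[of 1] show ?thesis
    by (intro that) (auto simp: c numeral_2_eq_2)
qed

lemma pure_gen_closed: "c \<in> pairs \<Longrightarrow> pure_gen c \<in> carrier G"
  by (elim pairsE) (simp only: pure_gen_eq G.m_closed G.inv_closed perm_part_carrier base_closed)

lemma perm_pairs: "x \<in> carrier G \<Longrightarrow> c \<in> pairs \<Longrightarrow> map_prod (perm x) (perm x) c \<in> pairs"
  using perm_in_range[of x] by (cases c) (simp add: pairs_def perm_eq_iff)

lemma pure_gen_conj:
  assumes x: "x \<in> perm_part" and c: "c \<in> pairs"
  shows "x \<otimes> pure_gen c = pure_gen (map_prod (perm x) (perm x) c) \<otimes> x"
proof -
  obtain y where y: "y \<in> perm_part" "c = (perm y 1, perm y 2)"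
    using c by (rule pairsE)
  have cl: "x \<in> carrier G" "y \<in> carrier G" "base \<in> carrier G"
    using x y by (simp_all add: perm_part_carrier base_closed)
  have "pure_gen (map_prod (perm x) (perm x) c) = pure_gen (perm (x \<otimes> y) 1, perm (x \<otimes> y) 2)"
    using cl by (simp add: y(2) perm_mult del: hom_mult)
  also have "\<dots> = (x \<otimes> y) \<otimes> base \<otimes> inv (x \<otimes> y)"
    using x y by (intro pure_gen_eq perm_part_mult)
  finally have "pure_gen (map_prod (perm x) (perm x) c) \<otimes> x = x \<otimes> (y \<otimes> base \<otimes> inv y)"
    using cl by (simp add: G.m_assoc G.inv_mult_group)
  then show ?thesis using pure_gen_eq[OF y(1)] y(2) by simp
qed

text \<open>The relation \<open>\<sigma>\<^sub>i\<rho>\<^sub>i\<^sub>+\<^sub>1\<rho>\<^sub>i = \<rho>\<^sub>i\<^sub>+\<^sub>1\<rho>\<^sub>i\<sigma>\<^sub>i\<^sub>+\<^sub>1\<close> and the braid relation of the \<open>\<rho>\<close> show that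
  \<open>\<rho>\<^sub>i\<^sub>+\<^sub>1\<rho>\<^sub>i\<close> conjugates \<open>\<sigma>\<^sub>i\<^sub>+\<^sub>1\<rho>\<^sub>i\<^sub>+\<^sub>1\<close> to \<open>\<sigma>\<^sub>i\<rho>\<^sub>i\<close>, and its permutation carries \<open>(i+1, i+2)\<close> to
  \<open>(i, i+1)\<close>.\<close>

lemma pure_gen_adjacent:
  assumes "1 \<le> i" "i < n"
  shows "pure_gen (i, Suc i) = \<sigma> i \<otimes> \<rho> i"
  using assms
proof (induction i rule: nat_induct_at_least)
  case base
  have "pure_gen (perm \<one> 1, perm \<one> 2) = \<one> \<otimes> base \<otimes> inv \<one>"
    by (rule pure_gen_eq[OF perm_part_one])
  then show ?case using base_closed by (simp add: sym_group_one base_def numeral_2_eq_2)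
next
  case (Suc i)
  let ?j = "Suc i" and ?y = "\<rho> (Suc i) \<otimes> \<rho> i"
  have cl: "\<sigma> i \<in> carrier G" "\<sigma> ?j \<in> carrier G" "\<rho> i \<in> carrier G" "\<rho> ?j \<in> carrier G"
    using Suc by (auto intro!: gen_closed)
  have y: "?y \<in> perm_part" using Suc by (intro perm_part_mult perm_part_r) auto
  have j: "(?j, Suc ?j) \<in> pairs" using Suc by (auto simp: pairs_def)
  have "perm ?y ?j = i" "perm ?y (Suc ?j) = ?j"
    using Suc cl by (simp_all add: perm_mult r_perm transpose_def del: hom_mult)
  then have "?y \<otimes> pure_gen (?j, Suc ?j) = pure_gen (i, ?j) \<otimes> ?y"
    using pure_gen_conj[OF y j] by simp
  also have "\<dots> = \<sigma> i \<otimes> (\<rho> i \<otimes> \<rho> ?j \<otimes> \<rho> i)"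
    using Suc cl by (simp add: G.m_assoc)
  also have "\<dots> = (\<sigma> i \<otimes> \<rho> ?j \<otimes> \<rho> i) \<otimes> \<rho> ?j"
    using Suc cl by (simp add: three_strand_relations(2)) (simp add: G.m_assoc)
  also have "\<dots> = ?y \<otimes> (\<sigma> ?j \<otimes> \<rho> ?j)"
    using Suc cl by (simp add: three_strand_relations(3)) (simp add: G.m_assoc)
  finally show ?case
    using cl pure_gen_closed[OF j] by simp
qed

lemma \<sigma>_eq:
  assumes "1 \<le> i" "i < n"
  shows "\<sigma> i = pure_gen (i, Suc i) \<otimes> \<rho> i"
proof -
  have "\<sigma> i \<in> carrier G" "\<rho> i \<in> carrier G" using assms by (auto intro!: gen_closed)
  then show ?thesis using assms by (simp add: pure_gen_adjacent G.m_assoc \<rho>_square)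
qed

lemma pure_gen_commute_transfer:
  assumes x: "x \<in> perm_part" and c: "c \<in> pairs" and d: "d \<in> pairs"
    and comm: "pure_gen c \<otimes> pure_gen d = pure_gen d \<otimes> pure_gen c"
  shows "pure_gen (map_prod (perm x) (perm x) c) \<otimes> pure_gen (map_prod (perm x) (perm x) d) =
    pure_gen (map_prod (perm x) (perm x) d) \<otimes> pure_gen (map_prod (perm x) (perm x) c)"
proof -
  let ?m = "map_prod (perm x) (perm x)"
  have xc: "x \<in> carrier G" using x by (rule perm_part_carrier)
  have move: "pure_gen (?m e) \<otimes> pure_gen (?m f) \<otimes> x = x \<otimes> (pure_gen e \<otimes> pure_gen f)"
    if "e \<in> pairs" "f \<in> pairs" for e f
  proof -
    have cl: "pure_gen e \<in> carrier G" "pure_gen f \<in> carrier G"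
      "pure_gen (?m e) \<in> carrier G" "pure_gen (?m f) \<in> carrier G"
      using that xc by (auto intro!: pure_gen_closed perm_pairs simp del: map_prod_simp)
    have "pure_gen (?m e) \<otimes> pure_gen (?m f) \<otimes> x = pure_gen (?m e) \<otimes> (x \<otimes> pure_gen f)"
      using cl xc by (simp add: pure_gen_conj[OF x that(2)] G.m_assoc)
    also have "\<dots> = (pure_gen (?m e) \<otimes> x) \<otimes> pure_gen f"
      using cl xc by (simp add: G.m_assoc)
    also have "\<dots> = x \<otimes> (pure_gen e \<otimes> pure_gen f)"
      using cl xc by (simp add: pure_gen_conj[OF x that(1), symmetric] G.m_assoc)
    finally show ?thesis .
  qed
  have "pure_gen (?m c) \<in> carrier G" "pure_gen (?m d) \<in> carrier G"
    using c d xc by (auto intro!: pure_gen_closed perm_pairs simp del: map_prod_simp)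
  then show ?thesis
    using move[OF c d] move[OF d c] comm xc by (metis G.m_closed G.right_cancel)
qed

lemma \<rho>_pure_gen:
  assumes "1 \<le> k" "k < n" "c \<in> pairs"
  shows "\<rho> k \<otimes> pure_gen c =
    pure_gen (map_prod (transpose k (Suc k)) (transpose k (Suc k)) c) \<otimes> \<rho> k"
  using pure_gen_conj[of "\<rho> k" c] assms by (simp add: perm_part_r r_perm)

lemma pure_gen_commute_three:
  assumes "3 \<le> n"
  shows "pure_gen (1, 3) \<otimes> pure_gen (2, 3) = pure_gen (2, 3) \<otimes> pure_gen (1, 3)" (is ?P1)
    "pure_gen (1, 3) \<otimes> pure_gen (1, 2) = pure_gen (1, 2) \<otimes> pure_gen (1, 3)" (is ?P2)
    "pure_gen (1, 2) \<otimes> pure_gen (2, 3) = pure_gen (2, 3) \<otimes> pure_gen (1, 2)" (is ?P3)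
proof -
  have p: "(1, 2) \<in> pairs" "(2, 3) \<in> pairs" "(1, 3) \<in> pairs"
    using assms by (auto simp: pairs_def)
  have cl: "pure_gen (1, 2) \<in> carrier G" "pure_gen (2, 3) \<in> carrier G"
    "pure_gen (1, 3) \<in> carrier G" "\<rho> 1 \<in> carrier G" "\<rho> 2 \<in> carrier G"
    using p pure_gen_closed assms by (auto intro!: gen_closed simp del: One_nat_def)
  have s: "\<sigma> 1 = pure_gen (1, 2) \<otimes> \<rho> 1" "\<sigma> 2 = pure_gen (2, 3) \<otimes> \<rho> 2"
    using \<sigma>_eq[of 1] \<sigma>_eq[of 2] assms by (simp_all add: numeral_2_eq_2 numeral_3_eq_3)
  have move: "\<rho> 1 \<otimes> pure_gen (2, 3) = pure_gen (1, 3) \<otimes> \<rho> 1"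
    "\<rho> 2 \<otimes> pure_gen (1, 2) = pure_gen (1, 3) \<otimes> \<rho> 2"
    "\<rho> 1 \<otimes> pure_gen (1, 3) = pure_gen (2, 3) \<otimes> \<rho> 1"
    "\<rho> 2 \<otimes> pure_gen (1, 3) = pure_gen (1, 2) \<otimes> \<rho> 2"
    using \<rho>_pure_gen[of 1 "(2, 3)"] \<rho>_pure_gen[of 2 "(1, 2)"]
      \<rho>_pure_gen[of 1 "(1, 3)"] \<rho>_pure_gen[of 2 "(1, 3)"] p assms
    by (simp_all add: transpose_def numeral_2_eq_2 numeral_3_eq_3)
  have rel: "\<rho> 1 \<otimes> \<rho> 2 \<otimes> \<rho> 1 = \<rho> 2 \<otimes> \<rho> 1 \<otimes> \<rho> 2"
    "\<rho> 1 \<otimes> \<sigma> 2 \<otimes> \<sigma> 1 = \<sigma> 2 \<otimes> \<sigma> 1 \<otimes> \<rho> 2"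
    "\<rho> 2 \<otimes> \<sigma> 1 \<otimes> \<sigma> 2 = \<sigma> 1 \<otimes> \<sigma> 2 \<otimes> \<rho> 1"
    "\<sigma> 1 \<otimes> \<sigma> 2 \<otimes> \<sigma> 1 = \<sigma> 2 \<otimes> \<sigma> 1 \<otimes> \<sigma> 2"
    using three_strand_relations[of 1] assms by (simp_all add: numeral_2_eq_2)
  note * = G.three_strand_commute[OF cl move rel(1) rel(2-4)[unfolded s]]
  show ?P1 ?P2 ?P3
    by (rule *)+
qed

lemma pure_gen_commute_four:
  assumes "4 \<le> n"
  shows "pure_gen (1, 2) \<otimes> pure_gen (3, 4) = pure_gen (3, 4) \<otimes> pure_gen (1, 2)"
proof -
  have cl: "\<sigma> 1 \<in> carrier G" "\<sigma> 3 \<in> carrier G" "\<rho> 1 \<in> carrier G" "\<rho> 3 \<in> carrier G"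
    using assms by (auto intro!: gen_closed)
  have eq: "pure_gen (1, 2) = \<sigma> 1 \<otimes> \<rho> 1" "pure_gen (3, 4) = \<sigma> 3 \<otimes> \<rho> 3"
    using pure_gen_adjacent[of 1] pure_gen_adjacent[of 3] assms
    by (simp_all add: numeral_2_eq_2)
  note comm = far_commute[of 1 3, simplified]
  have "\<sigma> 1 \<otimes> \<rho> 1 \<otimes> (\<sigma> 3 \<otimes> \<rho> 3) = \<sigma> 1 \<otimes> (\<rho> 1 \<otimes> \<sigma> 3) \<otimes> \<rho> 3"
    using cl by (simp add: G.m_assoc)
  also have "\<dots> = (\<sigma> 1 \<otimes> \<sigma> 3) \<otimes> (\<rho> 1 \<otimes> \<rho> 3)"
    using cl assms by (simp add: comm(4)) (simp add: G.m_assoc)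
  also have "\<dots> = \<sigma> 3 \<otimes> (\<sigma> 1 \<otimes> \<rho> 3) \<otimes> \<rho> 1"
    using cl assms by (simp add: comm(1,2)) (simp add: G.m_assoc)
  also have "\<dots> = \<sigma> 3 \<otimes> \<rho> 3 \<otimes> (\<sigma> 1 \<otimes> \<rho> 1)"
    using cl assms by (simp add: comm(3)) (simp add: G.m_assoc)
  finally show ?thesis by (simp only: eq)
qed

text \<open>Conjugation by the permutation part reduces all cases to one choice of strands for each
  pattern of coincidences between the indices.\<close>

lemma pure_gen_commute:
  assumes c: "c \<in> pairs" and d: "d \<in> pairs" and ne: "d \<noteq> c" "d \<noteq> prod.swap c"
  shows "pure_gen c \<otimes> pure_gen d = pure_gen d \<otimes> pure_gen c"
proof -
  have transfer: "pure_gen (xs ! a, xs ! b) \<otimes> pure_gen (xs ! a', xs ! b') =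
      pure_gen (xs ! a', xs ! b') \<otimes> pure_gen (xs ! a, xs ! b)"
    if xs: "distinct xs" "set xs \<subseteq> {1..n}" and
      idx: "a < length xs" "b < length xs" "a' < length xs" "b' < length xs" and
      ne: "a \<noteq> b" "a' \<noteq> b'" and
      comm: "pure_gen (Suc a, Suc b) \<otimes> pure_gen (Suc a', Suc b') =
       pure_gen (Suc a', Suc b') \<otimes> pure_gen (Suc a, Suc b)"
    for xs a b a' b'
  proof -
    obtain x where x: "x \<in> perm_part" "\<And>t. t < length xs \<Longrightarrow> perm x (Suc t) = xs ! t"
      using perm_part_multi_transitive[OF xs] by blast
    have "length xs \<le> n"
      using card_mono[OF _ xs(2)] distinct_card[OF xs(1)] by simp
    then have "(Suc a, Suc b) \<in> pairs" "(Suc a', Suc b') \<in> pairs"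
      using idx ne by (auto simp: pairs_def)
    from pure_gen_commute_transfer[OF x(1) this comm] show ?thesis
      using idx by (simp add: x(2))
  qed
  obtain i j k l where cd: "c = (i, j)" "d = (k, l)" by fastforce
  have r: "{i, j, k, l} \<subseteq> {1..n}" "i \<noteq> j" "k \<noteq> l"
    using c d by (auto simp: pairs_def cd)
  have three: "3 \<le> n" if "distinct [a, b, e]" "set [a, b, e] \<subseteq> {1..n}" for a b e :: nat
    using card_mono[OF _ that(2)] distinct_card[OF that(1)] by simp
  have four: "4 \<le> n" if "distinct [a, b, e, f]" "set [a, b, e, f] \<subseteq> {1..n}" for a b e f :: nat
    using card_mono[OF _ that(2)] distinct_card[OF that(1)] by simp
  consider "k = i" "l \<noteq> j" | "l = j" "k \<noteq> i" | "k = j" "l \<noteq> i" | "l = i" "k \<noteq> j"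
    | "distinct [i, j, k, l]"
    using ne r by (auto simp: cd)
  then show ?thesis
  proof cases
    case 1
    then have *: "distinct [i, l, j]" "set [i, l, j] \<subseteq> {1..n}" using r by auto
    from transfer[OF *, of 0 2 0 1] pure_gen_commute_three(2)[OF three[OF *]] 1
    show ?thesis by (simp add: cd numeral_2_eq_2 numeral_3_eq_3)
  next
    case 2
    then have *: "distinct [i, k, j]" "set [i, k, j] \<subseteq> {1..n}" using r by auto
    from transfer[OF *, of 0 2 1 2] pure_gen_commute_three(1)[OF three[OF *]] 2
    show ?thesis by (simp add: cd numeral_2_eq_2 numeral_3_eq_3)
  next
    case 3
    then have *: "distinct [i, j, l]" "set [i, j, l] \<subseteq> {1..n}" using r by auto
    from transfer[OF *, of 0 1 1 2] pure_gen_commute_three(3)[OF three[OF *]] 3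
    show ?thesis by (simp add: cd numeral_2_eq_2 numeral_3_eq_3)
  next
    case 4
    then have *: "distinct [k, i, j]" "set [k, i, j] \<subseteq> {1..n}" using r by auto
    from transfer[OF *, of 0 1 1 2] pure_gen_commute_three(3)[OF three[OF *]] 4
    show ?thesis by (simp add: cd numeral_2_eq_2 numeral_3_eq_3)
  next
    case 5
    then have *: "distinct [i, j, k, l]" "set [i, j, k, l] \<subseteq> {1..n}" using r by auto
    from transfer[OF *, of 0 1 2 3] pure_gen_commute_four[OF four[OF *]]
    show ?thesis by (simp add: cd numeral_2_eq_2 numeral_3_eq_3 numeral_eq_Suc)
  qed
qed

abbreviation pure_value :: "(nat \<times> nat) word \<Rightarrow> uvb_gen word set" where
  "pure_value \<equiv> word_value G pure_gen"

lemma pure_value_closed: "w \<in> words pairs \<Longrightarrow> pure_value w \<in> carrier G"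
  by (rule G.word_value_in_carrier) (auto simp: pure_gen_closed)

lemma pure_value_append:
  "u \<in> words pairs \<Longrightarrow> v \<in> words pairs \<Longrightarrow> pure_value (u @ v) = pure_value u \<otimes> pure_value v"
  by (rule G.word_value_append_carrier) (auto simp: pure_gen_closed)

lemma perm_pure_gen: "c \<in> pairs \<Longrightarrow> perm (pure_gen c) = id"
proof (elim pairsE)
  fix x assume x: "x \<in> perm_part" and c: "c = (perm x 1, perm x 2)"
  have cl: "x \<in> carrier G" "base \<in> carrier G" "\<sigma> 1 \<in> carrier G" "\<rho> 1 \<in> carrier G"
    using x two_le base_closed by (auto simp: perm_part_carrier intro!: gen_closed)
  have "perm base i = i" for i
    using cl two_le by (simp add: base_def perm_mult perm_gen del: hom_mult)
  then show "perm (pure_gen c) = id"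
    using x cl pure_gen_eq[OF x]
    by (simp add: c perm_mult perm_inv_cancel fun_eq_iff del: hom_mult hom_inv)
qed

lemma perm_pure_value: "w \<in> words pairs \<Longrightarrow> perm (pure_value w) = id"
proof (induction w)
  case (Cons l w)
  then have *: "fst l \<in> pairs" "perm (pure_value w) = id" "pure_value w \<in> carrier G"
    "pure_gen (fst l) \<in> carrier G"
    by (auto simp: pure_value_closed pure_gen_closed)
  then have "perm (inv (pure_gen (fst l))) i = i" for i
    using perm_inv_cancel(1)[of "pure_gen (fst l)" i] perm_pure_gen by simp
  then show ?case using * perm_pure_gen[of "fst l"]
    by (cases l) (auto simp: fun_eq_iff perm_mult simp del: hom_mult hom_inv)
qed (simp add: sym_group_one)

lemma pure_gen_conj_inv:
  assumes x: "x \<in> perm_part" and c: "c \<in> pairs"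
  shows "x \<otimes> inv (pure_gen c) = inv (pure_gen (map_prod (perm x) (perm x) c)) \<otimes> x"
proof -
  let ?d = "pure_gen (map_prod (perm x) (perm x) c)"
  have cl: "x \<in> carrier G" "pure_gen c \<in> carrier G" "?d \<in> carrier G"
    using x c by (auto intro!: pure_gen_closed perm_pairs simp: perm_part_carrier simp del: map_prod_simp)
  have "x = ?d \<otimes> x \<otimes> inv (pure_gen c)"
    using pure_gen_conj[OF x c] cl by (metis G.inv_solve_right G.m_closed)
  then have "inv ?d \<otimes> x = x \<otimes> inv (pure_gen c)"
    using cl by (metis G.inv_solve_left' G.m_assoc G.inv_closed G.m_closed)
  then show ?thesis by simp
qed

text \<open>Conjugation by the permutation part permutes the pure generators, so all generators \<open>\<rho>\<close> can be
  moved to the right end of a word.\<close>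

lemma pure_times_perm_part:
  assumes "g \<in> carrier G"
  obtains w x where "w \<in> words pairs" "x \<in> perm_part" "g = pure_value w \<otimes> x"
proof -
  have "\<exists>w x. w \<in> words pairs \<and> x \<in> perm_part \<and> word_value G gen u = pure_value w \<otimes> x"
    if "u \<in> words (uvb_gens n)" for u
    using that
  proof (induction u rule: rev_induct)
    case Nil
    show ?case by (intro exI[of _ "[]"] exI[of _ \<one>]) (simp add: perm_part_one)
  next
    case (snoc l u)
    then obtain w x where wx: "w \<in> words pairs" "x \<in> perm_part"
      "word_value G gen u = pure_value w \<otimes> x"
      by auto
    obtain y b where l: "l = (y, b)" by fastforce
    have y: "y \<in> uvb_gens n" using snoc.prems l by simp
    have cl: "pure_value w \<in> carrier G" "x \<in> carrier G" "gen y \<in> carrier G"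
      using wx y by (simp_all add: pure_value_closed perm_part_carrier gen_closed)
    define h where "h = (if b then gen y else inv (gen y))"
    have hc: "h \<in> carrier G" using cl by (simp add: h_def)
    have eq: "word_value G gen (u @ [l]) = pure_value w \<otimes> (x \<otimes> h)"
      using snoc.prems y cl hc wx
      by (subst G.word_value_append_carrier[of _ "uvb_gens n"])
        (auto simp: gen_closed l h_def G.m_assoc)
    show ?case
    proof (cases y)
      case (Rho k)
      then have k: "k \<in> {1..<n}" using y by simp
      have "h = \<rho> k" using k r_inv[of k] by (simp add: h_def Rho)
      then have "x \<otimes> h \<in> perm_part" using wx k by (simp add: perm_part_mult perm_part_r)
      then show ?thesis using eq wx by blast
    next
      case (Sig k)
      then have k: "1 \<le> k" "k < n" using y by auto
      define c where "c = (k, Suc k)"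
      have c: "c \<in> pairs" using k by (auto simp: c_def pairs_def)
      have rk: "\<rho> k \<in> perm_part" "\<rho> k \<in> carrier G" using k by (auto intro: perm_part_r \<rho>_closed)
      have pc: "pure_gen c \<in> carrier G" using c by (rule pure_gen_closed)
      have \<sigma>: "\<sigma> k = pure_gen c \<otimes> \<rho> k" using k by (simp add: \<sigma>_eq c_def)
      obtain d b' where d: "d \<in> pairs" "x \<otimes> h = pure_value [(d, b')] \<otimes> (x \<otimes> \<rho> k)"
      proof (cases b)
        case True
        have m: "map_prod (perm x) (perm x) c \<in> pairs" using cl(2) c by (rule perm_pairs)
        have "x \<otimes> h = x \<otimes> pure_gen c \<otimes> \<rho> k"
          using True cl pc rk by (simp add: h_def Sig \<sigma> G.m_assoc)
        also have "\<dots> = pure_value [(map_prod (perm x) (perm x) c, True)] \<otimes> (x \<otimes> \<rho> k)"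
          using pure_gen_conj[OF wx(2) c] cl rk pure_gen_closed[OF m] by (simp add: G.m_assoc)
        finally show ?thesis by (rule that[OF m])
      next
        case False
        define x' where "x' = x \<otimes> \<rho> k"
        have x': "x' \<in> perm_part" "x' \<in> carrier G"
          using wx rk perm_part_mult perm_part_carrier unfolding x'_def by blast+
        have m: "map_prod (perm x') (perm x') c \<in> pairs" using x'(2) c by (rule perm_pairs)
        have "x \<otimes> h = x' \<otimes> inv (pure_gen c)"
          using False cl pc rk k by (simp add: h_def Sig \<sigma> G.inv_mult_group r_inv x'_def G.m_assoc)
        also have "\<dots> = pure_value [(map_prod (perm x') (perm x') c, False)] \<otimes> x'"
          using pure_gen_conj_inv[OF x'(1) c] x' pure_gen_closed[OF m] by simp
        finally show ?thesis unfolding x'_def by (rule that[OF m[unfolded x'_def]])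
      qed
      have W: "w @ [(d, b')] \<in> words pairs" using wx d by simp
      have "word_value G gen (u @ [l]) = pure_value (w @ [(d, b')]) \<otimes> (x \<otimes> \<rho> k)"
        using d(1) wx(1) cl rk pure_value_closed[of "[(d, b')]"]
        by (simp add: eq d(2) pure_value_append G.m_assoc del: word_value_Cons)
      then show ?thesis using W perm_part_mult[OF wx(2) rk(1)] by blast
    qed
  qed
  moreover obtain u where "u \<in> words (uvb_gens n)" "g = word_value G gen u"
    using assms by (auto simp: G_presented presented_group_carrier gen_def word_class_eq_word_value)
  ultimately show ?thesis using that by blast
qed

lemma kernel_is_pure:
  assumes "g \<in> carrier G" "perm g = id"
  obtains w where "w \<in> words pairs" "g = pure_value w"
proof -
  obtain w x where wx: "w \<in> words pairs" "x \<in> perm_part" "g = pure_value w \<otimes> x"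
    using assms(1) by (rule pure_times_perm_part)
  have cl: "pure_value w \<in> carrier G" "x \<in> carrier G"
    using wx by (simp_all add: pure_value_closed perm_part_carrier)
  have "perm x i = i" for i
    using fun_cong[OF assms(2), of i] cl perm_pure_value[OF wx(1)]
    by (simp add: wx(3) perm_mult del: hom_mult)
  then have "x = \<one>" using wx(2) by (intro perm_part_eq_one) (auto simp: fun_eq_iff)
  then show ?thesis using that wx cl by simp
qed

end

section \<open>Finite permutation representations\<close>

lemma word_value_BijGroup:
  assumes "w \<in> words X" "\<And>x. x \<in> X \<Longrightarrow> f x \<in> Bij E" "\<And>x z. x \<in> X \<Longrightarrow> z \<in> E \<Longrightarrow> f x z = a x z"
    and "y \<in> E" "\<forall>l\<in>set w. snd l"
  shows "word_value (BijGroup E) f w y = foldr (\<lambda>l. a (fst l)) w y"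
proof -
  interpret B: group "BijGroup E" by (rule group_BijGroup)
  have carrier: "carrier (BijGroup E) = Bij E" by (simp add: BijGroup_def)
  have mult: "g \<otimes>\<^bsub>BijGroup E\<^esub> h = compose E g h" if "g \<in> Bij E" "h \<in> Bij E" for g h
    using that by (simp add: BijGroup_def)
  have one: "\<one>\<^bsub>BijGroup E\<^esub> = (\<lambda>x\<in>E. x)" by (simp add: BijGroup_def)
  have "word_value (BijGroup E) f w \<in> Bij E \<and>
    word_value (BijGroup E) f w y = foldr (\<lambda>l. a (fst l)) w y"
    using assms(1,5)
  proof (induction w)
    case Nil
    have "(\<lambda>x\<in>E. x) \<in> Bij E" using B.one_closed by (simp only: carrier one)
    then show ?case using assms(4) by (simp only: word_value_Nil one foldr.simps id_apply restrict_apply' simp_thms)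
  next
    case (Cons l w)
    let ?v = "word_value (BijGroup E) f w"
    have IH: "?v \<in> Bij E" "?v y = foldr (\<lambda>l. a (fst l)) w y" and l: "snd l" "fst l \<in> X"
      using Cons by auto
    have vy: "?v y \<in> E" using IH(1) assms(4) by (auto dest: Bij_imp_funcset)
    have "word_value (BijGroup E) f (l # w) = compose E (f (fst l)) ?v"
      using mult[OF assms(2)[OF l(2)] IH(1)] l(1) by (cases l) simp
    moreover have "compose E (f (fst l)) ?v \<in> Bij E"
      by (rule compose_Bij[OF assms(2)[OF l(2)] IH(1)])
    ultimately show ?case using assms(3)[OF l(2) vy] assms(4) IH(2)
      by (simp add: compose_eq)
  qed
  then show ?thesis ..
qed

text \<open>The change of state over the ordered pair \<open>d\<close> that is caused by the pure generator for \<open>c\<close>.\<close>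

definition twist :: "('a \<Rightarrow> 'a) \<Rightarrow> ('a \<Rightarrow> 'a) \<Rightarrow> nat \<times> nat \<Rightarrow> nat \<times> nat \<Rightarrow> 'a \<Rightarrow> 'a" where
  "twist A B c d = (if d = c then A else if d = prod.swap c then B else id)"

lemma twist_permutes: "A permutes S \<Longrightarrow> B permutes S \<Longrightarrow> twist A B c d permutes S"
  by (simp add: twist_def permutes_id)

lemma twist_comp: "twist A B c d (twist A B c d z) = twist (A \<circ> A) (B \<circ> B) c d z"
  by (simp add: twist_def)

text \<open>Points are pairs of strands together with a state. All generators permute the strands; the
  generators \<open>\<sigma>\<close> moreover change the state of the two ordered pairs made of their strands,
  by \<open>A\<close> for the increasing and by \<open>B\<close> for the decreasing pair.\<close>

fun gen_action ::
  "(nat \<Rightarrow> nat) \<Rightarrow> (nat \<Rightarrow> nat) \<Rightarrow> uvb_gen \<Rightarrow> (nat \<times> nat) \<times> nat \<Rightarrow> (nat \<times> nat) \<times> nat"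
where
  "gen_action A B (Rho k) ((p, q), z) = ((transpose k (Suc k) p, transpose k (Suc k) q), z)"
| "gen_action A B (Sig k) ((p, q), z) =
    ((transpose k (Suc k) p, transpose k (Suc k) q),
     twist A B (k, Suc k) (transpose k (Suc k) p, transpose k (Suc k) q) z)"

lemma gen_action_far:
  assumes "Suc i < j"
  shows "gen_action A B (Sig i) (gen_action A B (Sig j) y) = gen_action A B (Sig j) (gen_action A B (Sig i) y)" (is ?P1)
    "gen_action A B (Rho i) (gen_action A B (Rho j) y) = gen_action A B (Rho j) (gen_action A B (Rho i) y)" (is ?P2)
    "gen_action A B (Sig i) (gen_action A B (Rho j) y) = gen_action A B (Rho j) (gen_action A B (Sig i) y)" (is ?P3)
    "gen_action A B (Rho i) (gen_action A B (Sig j) y) = gen_action A B (Sig j) (gen_action A B (Rho i) y)" (is ?P4)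
proof -
  obtain p q z where y: "y = ((p, q), z)" by (metis surj_pair)
  have cases: "r = i \<or> r = Suc i \<or> r = j \<or> r = Suc j \<or> (r \<noteq> i \<and> r \<noteq> Suc i \<and> r \<noteq> j \<and> r \<noteq> Suc j)"
    for r by blast
  have ne: "i \<noteq> j" "Suc i \<noteq> j" "i \<noteq> Suc j" using assms by auto
  show ?P1 ?P2 ?P3 ?P4
    \<comment> \<open>with this many disequations linear arithmetic would split far too often; rewriting suffices\<close>
    using cases[of p] cases[of q] ne [[linarith_neq_limit = 0]] unfolding y
    by (elim disjE; simp add: twist_def transpose_def)+
qed

lemma gen_action_three_strands:
  fixes i :: nat
  defines "j \<equiv> Suc i"
  shows "gen_action A B (Sig i) (gen_action A B (Sig j) (gen_action A B (Sig i) y)) =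
      gen_action A B (Sig j) (gen_action A B (Sig i) (gen_action A B (Sig j) y))" (is ?P1)
    "gen_action A B (Rho i) (gen_action A B (Rho j) (gen_action A B (Rho i) y)) =
      gen_action A B (Rho j) (gen_action A B (Rho i) (gen_action A B (Rho j) y))" (is ?P2)
    "gen_action A B (Sig i) (gen_action A B (Rho j) (gen_action A B (Rho i) y)) =
      gen_action A B (Rho j) (gen_action A B (Rho i) (gen_action A B (Sig j) y))" (is ?P3)
    "gen_action A B (Rho i) (gen_action A B (Sig j) (gen_action A B (Sig i) y)) =
      gen_action A B (Sig j) (gen_action A B (Sig i) (gen_action A B (Rho j) y))" (is ?P4)
    "gen_action A B (Rho j) (gen_action A B (Sig i) (gen_action A B (Sig j) y)) =
      gen_action A B (Sig i) (gen_action A B (Sig j) (gen_action A B (Rho i) y))" (is ?P5)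
proof -
  obtain p q z where y: "y = ((p, q), z)" by (metis surj_pair)
  have cases: "r = i \<or> r = Suc i \<or> r = Suc (Suc i) \<or> (r \<noteq> i \<and> r \<noteq> Suc i \<and> r \<noteq> Suc (Suc i))"
    for r by blast
  show ?P1 ?P2 ?P3 ?P4 ?P5
    using cases[of p] cases[of q] unfolding y j_def
    by (elim disjE; simp add: twist_def transpose_def)+
qed

lemma gen_action_involution: "gen_action A B (Rho i) (gen_action A B (Rho i) y) = y"
  by (cases y) auto

lemma gen_action_relation:
  assumes "(u, v) \<in> uvb_rels n"
  shows "foldr (\<lambda>l. gen_action A B (fst l)) u y = foldr (\<lambda>l. gen_action A B (fst l)) v y"
proof -
  have far: "far n i j \<Longrightarrow> Suc i < j \<or> Suc j < i" for i j by (auto simp: far_def)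
  show ?thesis
    using assms unfolding uvb_rels_def
    by (auto simp: gen_action_three_strands gen_action_involution simp del: gen_action.simps
        dest!: far intro: gen_action_far gen_action_far[symmetric])
qed

context unrestricted_virtual_braid
begin

definition points :: "nat \<Rightarrow> ((nat \<times> nat) \<times> nat) set" where
  "points N = ({1..n} \<times> {1..n}) \<times> {..N}"

definition rep_gen :: "nat \<Rightarrow> (nat \<Rightarrow> nat) \<Rightarrow> (nat \<Rightarrow> nat) \<Rightarrow> uvb_gen \<Rightarrow>
    (nat \<times> nat) \<times> nat \<Rightarrow> (nat \<times> nat) \<times> nat" where
  "rep_gen N A B x = restrict (gen_action A B x) (points N)"

definition rep :: "nat \<Rightarrow> (nat \<Rightarrow> nat) \<Rightarrow> (nat \<Rightarrow> nat) \<Rightarrow> uvb_gen word set \<Rightarrow>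
    (nat \<times> nat) \<times> nat \<Rightarrow> (nat \<times> nat) \<times> nat" where
  "rep N A B = presented_lift (BijGroup (points N)) (rep_gen N A B)"

lemma finite_points: "finite (points N)"
  by (simp add: points_def)

lemma transpose_in_range:
  "k \<in> {1..<n} \<Longrightarrow> transpose k (Suc k) i \<in> {1..n} \<longleftrightarrow> i \<in> {1..n}"
  by (rule permutes_in_image) (auto intro: permutes_swap_id)

lemma rep_gen_Bij:
  assumes A: "A permutes {..N}" and B: "B permutes {..N}" and x: "x \<in> uvb_gens n"
  shows "rep_gen N A B x \<in> Bij (points N)"
proof -
  obtain k where k: "k \<in> {1..<n}" "x = Sig k \<or> x = Rho k"
    using x by (cases x) auto
  have tw: "twist A B c d permutes {..N}" for c d
    using A B by (rule twist_permutes)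
  have "gen_action A B x y \<in> points N" if "y \<in> points N" for y
    using k that transpose_in_range[OF k(1)] permutes_in_image[OF tw]
    by (cases y) (auto simp: points_def simp del: atMost_iff atLeastAtMost_iff)
  moreover have "inj_on (gen_action A B x) (points N)"
  proof (rule inj_onI)
    fix y y' assume eq: "gen_action A B x y = gen_action A B x y'"
    obtain p q z p' q' z' where y: "y = ((p, q), z)" "y' = ((p', q'), z')" by (metis surj_pair)
    show "y = y'"
      using eq k(2) inj_eq[OF permutes_inj[OF tw]] by (auto simp: y transpose_eq_iff)
  qed
  ultimately have "bij_betw (gen_action A B x) (points N) (points N)"
    using finite_points by (simp add: bij_betw_def endo_inj_surj image_subsetI)
  then show ?thesis by (simp add: rep_gen_def Bij_def)
qed

end

locale unrestricted_virtual_braid_rep = unrestricted_virtual_braid +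
  fixes N :: nat and A B :: "nat \<Rightarrow> nat"
  assumes A: "A permutes {..N}" and B: "B permutes {..N}"
begin

lemma rep_gen_closed: "x \<in> uvb_gens n \<Longrightarrow> rep_gen N A B x \<in> carrier (BijGroup (points N))"
  using rep_gen_Bij[OF A B] by (simp add: BijGroup_def)

lemma rep_gen_relation:
  assumes "(u, v) \<in> uvb_rels n" "u \<in> words (uvb_gens n)" "v \<in> words (uvb_gens n)"
  shows "word_value (BijGroup (points N)) (rep_gen N A B) u =
    word_value (BijGroup (points N)) (rep_gen N A B) v"
proof -
  interpret B: group "BijGroup (points N)" by (rule group_BijGroup)
  have pos: "\<forall>l\<in>set u. snd l" "\<forall>l\<in>set v. snd l"
    using assms(1) by (auto simp: uvb_rels_def)
  have Bij: "rep_gen N A B x \<in> Bij (points N)" if "x \<in> uvb_gens n" for x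
    using A B that by (rule rep_gen_Bij)
  have val: "rep_gen N A B x z = gen_action A B x z" if "z \<in> points N" for x z
    using that by (simp add: rep_gen_def)
  have ext: "word_value (BijGroup (points N)) (rep_gen N A B) w \<in> extensional (points N)"
    if "w \<in> words (uvb_gens n)" for w
    using B.word_value_in_carrier[OF that, of "rep_gen N A B"] rep_gen_closed
    by (auto simp: BijGroup_def intro: Bij_imp_extensional)
  show ?thesis
    using ext[OF assms(2)] ext[OF assms(3)]
  proof (rule extensionalityI)
    fix y assume y: "y \<in> points N"
    show "word_value (BijGroup (points N)) (rep_gen N A B) u y =
        word_value (BijGroup (points N)) (rep_gen N A B) v y"
      using word_value_BijGroup[OF assms(2) Bij val y pos(1)] word_value_BijGroup[OF assms(3) Bij val y pos(2)]
        gen_action_relation[OF assms(1)]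
      by simp
  qed
qed

lemma rep_hom: "rep N A B \<in> hom G (BijGroup (points N))"
  unfolding rep_def G_presented
  by (intro presented_lift_hom group_BijGroup rep_gen_closed rep_gen_relation)

lemma rep_gen: "x \<in> uvb_gens n \<Longrightarrow> rep N A B (gen x) = rep_gen N A B x"
  unfolding rep_def gen_def presented_gen_def
  by (intro presented_lift_gen group_BijGroup rep_gen_closed rep_gen_relation)

sublocale action: group_action G "points N" "rep N A B"
  using rep_hom group_G by (simp add: group_action_def group_hom_def group_hom_axioms_def group_BijGroup)

lemma rep_\<rho>:
  "k \<in> {1..<n} \<Longrightarrow> ((p, q), z) \<in> points N \<Longrightarrow>
    rep N A B (\<rho> k) ((p, q), z) = ((perm (\<rho> k) p, perm (\<rho> k) q), z)"
  by (simp add: rep_gen rep_gen_def r_perm)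

lemma points_perm: "x \<in> carrier G \<Longrightarrow> ((p, q), z) \<in> points N \<Longrightarrow> ((perm x p, perm x q), z) \<in> points N"
  using perm_in_range[of x] by (simp add: points_def)

lemma rep_one: "y \<in> points N \<Longrightarrow> rep N A B \<one> y = y"
  using action.id_eq_one by (metis restrict_apply')

lemma rep_perm_part:
  assumes "x \<in> perm_part" "((p, q), z) \<in> points N"
  shows "rep N A B x ((p, q), z) = ((perm x p, perm x q), z)"
proof -
  obtain u where u: "x = r_prod u" "set u \<subseteq> {1..<n}"
    using assms(1) by (auto simp: perm_part_def)
  have "rep N A B (r_prod u) ((p, q), z) = ((perm (r_prod u) p, perm (r_prod u) q), z)"
    using u(2)
  proof (induction u)
    case Nil
    then show ?case using assms(2) by (simp add: rep_one perm_one del: hom_one)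
  next
    case (Cons k u)
    then have cl: "\<rho> k \<in> carrier G" "r_prod u \<in> carrier G" "k \<in> {1..<n}"
      by (auto intro!: r_closed r_prod_closed)
    then show ?case
      using Cons action.composition_rule[OF assms(2) cl(1,2)]
        rep_\<rho>[OF cl(3) points_perm[OF cl(2) assms(2)]]
      by (simp add: perm_mult del: hom_mult)
  qed
  then show ?thesis by (simp add: u(1))
qed

lemma rep_base:
  assumes "((p, q), z) \<in> points N"
  shows "rep N A B base ((p, q), z) = ((p, q), twist A B (1, 2) (p, q) z)"
proof -
  have k: "1 \<in> {1..<n}" using two_le by simp
  have cl: "\<sigma> 1 \<in> carrier G" "\<rho> 1 \<in> carrier G" using k by (auto intro!: gen_closed)
  have "rep N A B base ((p, q), z) = rep N A B (\<sigma> 1) ((perm (\<rho> 1) p, perm (\<rho> 1) q), z)"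
    unfolding base_def using action.composition_rule[OF assms cl] rep_\<rho>[OF k assms] by simp
  also have "\<dots> = gen_action A B (Sig 1) ((perm (\<rho> 1) p, perm (\<rho> 1) q), z)"
    using points_perm[OF cl(2) assms] k by (simp add: rep_gen rep_gen_def)
  finally show ?thesis using k by (simp add: r_perm numeral_2_eq_2)
qed

lemma twist_in_points:
  "((p, q), z) \<in> points N \<Longrightarrow> ((p, q), twist A B c (p', q') z) \<in> points N"
  using permutes_in_image[OF twist_permutes[OF A B]] by (simp add: points_def del: atMost_iff)

lemma rep_pure_gen:
  assumes c: "c \<in> pairs" and y: "((p, q), z) \<in> points N"
  shows "rep N A B (pure_gen c) ((p, q), z) = ((p, q), twist A B c (p, q) z)"
proof -
  obtain x where x: "x \<in> perm_part" "c = (perm x 1, perm x 2)"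
    using c by (rule pairsE)
  have cl: "x \<in> carrier G" "inv x \<in> carrier G" "base \<in> carrier G"
    using x by (simp_all add: perm_part_carrier base_closed)
  define p' q' where "p' = perm (inv x) p" and "q' = perm (inv x) q"
  have pq: "p = perm x p'" "q = perm x q'"
    using cl by (simp_all add: p'_def q'_def perm_inv_cancel del: hom_inv)
  have y': "((p', q'), z) \<in> points N"
    unfolding p'_def q'_def by (rule points_perm[OF cl(2) y])
  have "rep N A B (pure_gen c) ((p, q), z) = rep N A B (x \<otimes> base) (rep N A B (inv x) ((p, q), z))"
    using pure_gen_eq[OF x(1)] cl y x(2) by (simp add: action.composition_rule)
  also have "\<dots> = rep N A B (x \<otimes> base) ((p', q'), z)"
    using rep_perm_part[OF perm_part_inv[OF x(1)] y] by (simp add: p'_def q'_def del: hom_inv)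
  also have "\<dots> = rep N A B x ((p', q'), twist A B (1, 2) (p', q') z)"
    using cl y' by (simp add: action.composition_rule rep_base)
  also have "\<dots> = ((p, q), twist A B (1, 2) (p', q') z)"
    using rep_perm_part[OF x(1) twist_in_points[OF y']] pq by simp
  also have "twist A B (1, 2) (p', q') = twist A B c (p, q)"
    using cl(1) by (simp add: twist_def x(2) pq perm_eq_iff)
  finally show ?thesis .
qed

lemma rep_pure_value:
  assumes w: "w \<in> words pairs" and y: "((p, q), z) \<in> points N"
  shows "rep N A B (pure_value w) ((p, q), z) = ((p, q), word_perm (\<lambda>c. twist A B c (p, q)) w z)
    \<and> ((p, q), word_perm (\<lambda>c. twist A B c (p, q)) w z) \<in> points N"
  using w
proof (induction w)
  case Nil
  then show ?case using y by (simp add: rep_one)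
next
  case (Cons l w)
  obtain c b where l: "l = (c, b)" by fastforce
  let ?t = "twist A B c (p, q)" and ?z = "word_perm (\<lambda>c. twist A B c (p, q)) w z"
  have w: "w \<in> words pairs" and c: "c \<in> pairs" using Cons.prems by (auto simp: l)
  have cl: "pure_gen c \<in> carrier G" "inv (pure_gen c) \<in> carrier G" "pure_value w \<in> carrier G"
    using w c by (simp_all add: pure_gen_closed pure_value_closed)
  have IH: "rep N A B (pure_value w) ((p, q), z) = ((p, q), ?z)" "((p, q), ?z) \<in> points N"
    using Cons.IH[OF w] by auto
  have t: "?t permutes {..N}" using A B by (rule twist_permutes)
  show ?case
  proof (cases b)
    case True
    then show ?thesis
      using action.composition_rule[OF y cl(1,3)] rep_pure_gen[OF c IH(2)] IH twist_in_points[OF IH(2)]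
      by (simp add: l)
  next
    case False
    have y': "((p, q), inv' ?t ?z) \<in> points N"
      using IH(2) permutes_in_image[OF permutes_inv[OF t]] by (simp add: points_def del: atMost_iff)
    have "rep N A B (pure_gen c) ((p, q), inv' ?t ?z) = ((p, q), ?z)"
      using rep_pure_gen[OF c y'] permutes_inverses(1)[OF t] by simp
    then have "rep N A B (inv (pure_gen c)) ((p, q), ?z) = ((p, q), inv' ?t ?z)"
      by (rule action.orbit_sym_aux[OF cl(1) y'])
    then show ?thesis
      using action.composition_rule[OF y cl(2,3)] IH y' False by (simp add: l)
  qed
qed

end

context unrestricted_virtual_braid
begin

text \<open>A non-trivial permutation is visible in the action on the pairs. If the permutation is trivial,
  choose a shortest pure word for the element and a pair of strands that occurs in it. The letters
  for this pair form a reduced word: two adjacent cancelling ones could be brought together in the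
  full word, because the letters in between belong to other pairs and commute with them, and
  the word could be shortened. Over the chosen pair the element acts by this reduced word, and
  finite permutations for which a reduced word moves a point can be taken to be squares.\<close>

lemma separated_by_rep:
  assumes g: "g \<in> carrier G" "g \<noteq> \<one>"
  obtains N A B where "A permutes {..N}" "B permutes {..N}"
    "rep N (A \<circ> A) (B \<circ> B) g \<noteq> \<one>\<^bsub>BijGroup (points N)\<^esub>"
proof (cases "perm g = id")
  case False
  \<comment> \<open>a single state suffices, since the permutation already acts on the pairs; \<open>id\<close> is a square\<close>
  interpret R: unrestricted_virtual_braid_rep n G 0 id id
    by unfold_locales (simp_all add: permutes_id)
  obtain w x where wx: "w \<in> words pairs" "x \<in> perm_part" "g = pure_value w \<otimes> x"
    using g(1) by (rule pure_times_perm_part)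
  have cl: "pure_value w \<in> carrier G" "x \<in> carrier G"
    using wx by (simp_all add: pure_value_closed perm_part_carrier)
  obtain p where p: "perm g p \<noteq> p" using False by (auto simp: fun_eq_iff)
  have xp: "perm x p \<noteq> p"
    using p cl perm_pure_value[OF wx(1)] by (simp add: wx(3) perm_mult del: hom_mult)
  have "p \<in> {1..n}"
    using p permutes_not_in[OF perm_permutes[OF g(1)]] by blast
  then have y: "((p, p), 0) \<in> points 0" by (simp add: points_def)
  have "fst (rep 0 id id g ((p, p), 0)) = (perm x p, perm x p)"
    using R.action.composition_rule[OF y cl] R.rep_perm_part[OF wx(2) y]
      R.rep_pure_value[OF wx(1) R.points_perm[OF cl(2) y]]
    by (simp add: wx(3))
  then have "rep 0 (id \<circ> id) (id \<circ> id) g \<noteq> \<one>\<^bsub>BijGroup (points 0)\<^esub>"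
    using xp y by (auto simp: BijGroup_def)
  then show ?thesis by (rule that[OF permutes_id permutes_id])
next
  case True
  define spells where "spells w \<longleftrightarrow> w \<in> words pairs \<and> g = pure_value w" for w
  have "\<exists>w. spells w"
    using kernel_is_pure[OF g(1) True] unfolding spells_def by blast
  then obtain w where w: "spells w" and min: "\<And>v. spells v \<Longrightarrow> length w \<le> length v"
    using ex_has_least_nat[of spells _ length] by blast
  have wp: "w \<in> words pairs" "g = pure_value w" using w by (auto simp: spells_def)
  have "w \<noteq> []" using g(2) wp by auto
  then obtain l where l: "l \<in> set w" by (meson list.set_sel(1))
  define c where "c = fst l"
  have c: "c \<in> pairs" using wp(1) l by (auto simp: words_def c_def lists_eq_set)
  obtain i j where ij: "c = (i, j)" by fastforce
  define on where "on m \<longleftrightarrow> fst m = c \<or> fst m = prod.swap c" for m :: "(nat \<times> nat) \<times> bool"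
  have "filter on w \<noteq> []" using l by (auto simp: on_def c_def filter_empty_conv)
  moreover have "reduced (filter on w)"
  proof (rule ccontr)
    assume "\<not> reduced (filter on w)"
    then obtain u d b v where uv: "filter on w = u @ (d, b) # (d, \<not> b) # v"
      by (rule not_reducedE)
    have "\<exists>w1 w'. w = w1 @ w' \<and> filter on w' = (d, b) # (d, \<not> b) # v"
      using uv
    proof (induction u arbitrary: w)
      case (Cons m u)
      then obtain us vs where "w = us @ m # vs" "filter on vs = u @ (d, b) # (d, \<not> b) # v"
        by (auto simp: filter_eq_Cons_iff)
      moreover from Cons.IH[OF this(2)]
      obtain w1 w' where "vs = w1 @ w'" "filter on w' = (d, b) # (d, \<not> b) # v" by blast
      ultimately show ?case by (intro exI[of _ "us @ m # w1"] exI[of _ w']) simp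
    qed auto
    then obtain w1 w' where 1: "w = w1 @ w'" "filter on w' = (d, b) # (d, \<not> b) # v"
      by blast
    obtain w2 w'' where 2: "w' = w2 @ (d, b) # w''" "filter on w'' = (d, \<not> b) # v" "on (d, b)"
      using filter_eq_ConsD[OF 1(2)] by metis
    then obtain w3 w4 where 3: "w'' = w3 @ (d, \<not> b) # w4" "\<forall>m\<in>set w3. \<not> on m"
      by (auto simp: filter_eq_Cons_iff)
    have split: "w = (w1 @ w2) @ [(d, b)] @ w3 @ [(d, \<not> b)] @ w4"
      by (simp add: 1 2 3)
    have W: "w1 @ w2 \<in> words pairs" "w3 \<in> words pairs" "w4 \<in> words pairs" "d \<in> pairs"
      using wp(1) unfolding split by auto
    define e where "e = pure_value [(d, b)]"
    have cl: "pure_value (w1 @ w2) \<in> carrier G" "pure_value w3 \<in> carrier G"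
      "pure_value w4 \<in> carrier G" "pure_gen d \<in> carrier G" "e \<in> carrier G"
      using W by (auto simp: e_def pure_value_closed pure_gen_closed simp del: words_append)
    have d: "d = c \<or> d = prod.swap c" using 2(3) by (simp add: on_def)
    have "pure_gen d \<otimes> pure_value w3 = pure_value w3 \<otimes> pure_gen d"
      using W(2) 3(2)
    proof (induction w3)
      case (Cons m w3)
      obtain a b' where m: "m = (a, b')" by fastforce
      have a: "a \<in> pairs" "a \<noteq> d" "a \<noteq> prod.swap d"
        using Cons.prems d by (auto simp: m on_def)
      have IH: "pure_gen d \<otimes> pure_value w3 = pure_value w3 \<otimes> pure_gen d"
        using Cons by simp
      have cl': "pure_gen a \<in> carrier G" "pure_value w3 \<in> carrier G"
        using Cons.prems a by (simp_all add: pure_gen_closed pure_value_closed)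
      have ad: "pure_gen d \<otimes> pure_gen a = pure_gen a \<otimes> pure_gen d"
        using pure_gen_commute[OF W(4) a] .
      have "pure_gen d \<otimes> inv (pure_gen a) = inv (pure_gen a) \<otimes> pure_gen d"
        using ad cl(4) cl'(1) by (metis G.inv_closed G.inv_solve_left G.inv_solve_right G.m_assoc G.m_closed)
      with ad have "pure_gen d \<otimes> pure_value [m] = pure_value [m] \<otimes> pure_gen d"
        using cl' by (simp add: m)
      moreover have "pure_value [m] \<in> carrier G" using cl' by (simp add: m)
      moreover have "pure_value (m # w3) = pure_value [m] \<otimes> pure_value w3"
        using cl' by (simp add: m)
      ultimately show ?case using IH cl(4) cl'(2) by (metis G.m_assoc)
    qed (simp add: cl(4))
    then have comm: "e \<otimes> pure_value w3 = pure_value w3 \<otimes> e"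
      using cl by (cases b)
        (simp_all add: e_def, metis G.inv_closed G.inv_solve_left G.inv_solve_right G.m_assoc G.m_closed)
    have cancel: "e \<otimes> pure_value [(d, \<not> b)] = \<one>" and
      e': "pure_value [(d, \<not> b)] \<in> carrier G"
      using cl(4) by (cases b; simp add: e_def)+
    have "g = pure_value (w1 @ w2) \<otimes> (e \<otimes> (pure_value w3 \<otimes> (pure_value [(d, \<not> b)] \<otimes> pure_value w4)))"
      using W unfolding wp(2) split e_def
      by (simp add: pure_value_append del: word_value_Cons append_assoc append.simps)
    also have "\<dots> = pure_value (w1 @ w2) \<otimes> (pure_value w3 \<otimes> ((e \<otimes> pure_value [(d, \<not> b)]) \<otimes> pure_value w4))"
      using cl e' comm by (metis G.m_assoc G.m_closed)
    also have "\<dots> = pure_value ((w1 @ w2) @ w3 @ w4)"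
      using W cl unfolding cancel by (simp add: pure_value_append del: append_assoc)
    finally have "spells ((w1 @ w2) @ w3 @ w4)"
      using W by (simp add: spells_def)
    from min[OF this] show False by (simp add: split)
  qed
  ultimately obtain N and f :: "nat \<times> nat \<Rightarrow> nat \<Rightarrow> nat"
    where f: "\<And>c. f c permutes {..N}" "word_perm (\<lambda>c. f c \<circ> f c) (filter on w) 0 \<noteq> 0"
    using reduced_word_moves_point_squares by blast
  define A B where "A = f c" and "B = f (prod.swap c)"
  interpret R: unrestricted_virtual_braid_rep n G N "A \<circ> A" "B \<circ> B"
    by unfold_locales (simp_all add: A_def B_def f permutes_compose)
  have ne: "prod.swap c \<noteq> c" using c by (auto simp: pairs_def)
  \<comment> \<open>over the pair \<open>c\<close> only the letters for \<open>c\<close> and its reverse act\<close>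
  have "word_perm (\<lambda>d. twist (A \<circ> A) (B \<circ> B) d c) v z = word_perm (\<lambda>d. f d \<circ> f d) (filter on v) z" for v z
  proof (induction v)
    case (Cons m v)
    obtain d b where m: "m = (d, b)" by fastforce
    have sw: "c = prod.swap d \<longleftrightarrow> d = prod.swap c" by auto
    show ?case using Cons ne
      by (auto simp: m on_def twist_def sw A_def B_def)
  qed simp
  moreover have y: "((i, j), 0) \<in> points N" using c by (auto simp: points_def pairs_def ij)
  ultimately have "rep N (A \<circ> A) (B \<circ> B) g ((i, j), 0) \<noteq> ((i, j), 0)"
    using R.rep_pure_value[OF wp(1) y] f(2) by (simp add: wp(2) ij)
  then have "rep N (A \<circ> A) (B \<circ> B) g \<noteq> \<one>\<^bsub>BijGroup (points N)\<^esub>"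
    using y by (auto simp: BijGroup_def)
  then show ?thesis by (intro that[of A N B]) (simp_all add: A_def B_def f)
qed

end

section \<open>The squaring endomorphism\<close>

context unrestricted_virtual_braid
begin

text \<open>With \<open>\<sigma>\<^sub>i = \<lambda>\<rho>\<^sub>i\<close>, where \<open>\<lambda>\<close> belongs to the pair \<open>(i, i+1)\<close>, the word \<open>\<sigma>\<^sub>i\<rho>\<^sub>i\<sigma>\<^sub>i\<close> equals
  \<open>\<lambda>\<^sup>2\<rho>\<^sub>i\<close>; so the \<open>\<rho>\<^sub>i\<close> are fixed and the pure generators are squared.\<close>

definition square_gen :: "uvb_gen \<Rightarrow> uvb_gen word set" where
  "square_gen x = (case x of Sig i \<Rightarrow> \<sigma> i \<otimes> \<rho> i \<otimes> \<sigma> i | Rho i \<Rightarrow> \<rho> i)"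

definition square_end :: "uvb_gen word set \<Rightarrow> uvb_gen word set" where
  "square_end = presented_lift G square_gen"

lemma square_gen_closed: "x \<in> uvb_gens n \<Longrightarrow> square_gen x \<in> carrier G"
  by (cases x) (simp_all add: square_gen_def \<sigma>_closed \<rho>_closed)

end

context unrestricted_virtual_braid_rep
begin

lemma rep_square_gen:
  assumes x: "x \<in> uvb_gens n"
  shows "rep N A B (square_gen x) = rep_gen N (A \<circ> A) (B \<circ> B) x"
proof (rule extensionalityI)
  show "rep N A B (square_gen x) \<in> extensional (points N)"
    using action.bij_prop0[OF square_gen_closed[OF x]] by (rule Bij_imp_extensional)
  show "rep_gen N (A \<circ> A) (B \<circ> B) x \<in> extensional (points N)"
    by (simp add: rep_gen_def)
  fix y assume y: "y \<in> points N"
  have app: "rep N A B (gen u) z = gen_action A B u z" "gen_action A B u z \<in> points N"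
    if "u \<in> uvb_gens n" "z \<in> points N" for u z
    using rep_gen[OF that(1)] action.element_image[OF gen_closed[OF that(1)] that(2)] that(2)
    by (simp_all add: rep_gen_def)
  show "rep N A B (square_gen x) y = rep_gen N (A \<circ> A) (B \<circ> B) x y"
  proof (cases x)
    case (Rho k)
    then show ?thesis using x y rep_gen[of "Rho k"]
      by (cases y) (auto simp: square_gen_def rep_gen_def)
  next
    case (Sig k)
    then have k: "Sig k \<in> uvb_gens n" "Rho k \<in> uvb_gens n" using x by simp_all
    have "rep N A B (square_gen x) y =
        gen_action A B (Sig k) (gen_action A B (Rho k) (gen_action A B (Sig k) y))"
      using k y app by (simp add: square_gen_def Sig action.composition_rule gen_closed)
    also have "\<dots> = gen_action (A \<circ> A) (B \<circ> B) (Sig k) y"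
      by (cases y) (auto simp: twist_comp)
    finally show ?thesis using y by (simp add: rep_gen_def Sig)
  qed
qed

lemma rep_word_square:
  assumes "w \<in> words (uvb_gens n)"
  shows "rep N A B (word_value G square_gen w) =
    word_value (BijGroup (points N)) (rep_gen N (A \<circ> A) (B \<circ> B)) w"
proof -
  interpret R: group_hom G "BijGroup (points N)" "rep N A B"
    by (rule action.group_hom)
  have "rep N A B (word_value G square_gen w) =
      word_value (BijGroup (points N)) (\<lambda>x. rep N A B (square_gen x)) w"
    using assms by (rule R.hom_word_value) (auto simp: square_gen_closed)
  also have "\<dots> = word_value (BijGroup (points N)) (rep_gen N (A \<circ> A) (B \<circ> B)) w"
    using assms by (rule word_value_cong) (rule rep_square_gen)
  finally show ?thesis .
qed

lemma square_rep: "unrestricted_virtual_braid_rep n G N (A \<circ> A) (B \<circ> B)"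
  by unfold_locales (simp_all add: permutes_compose A B)

end

context unrestricted_virtual_braid
begin

lemma repI:
  "A permutes {..N} \<Longrightarrow> B permutes {..N} \<Longrightarrow> unrestricted_virtual_braid_rep n G N A B"
  by unfold_locales

text \<open>No computation in the group is needed: composing the assignment with the
  representation for \<open>A, B\<close> gives the representation for \<open>A\<^sup>2, B\<^sup>2\<close>, which respects the
  relations, and these representations separate the elements.\<close>

lemma square_gen_relation:
  assumes uv: "(u, v) \<in> uvb_rels n" "u \<in> words (uvb_gens n)" "v \<in> words (uvb_gens n)"
  shows "word_value G square_gen u = word_value G square_gen v"
proof (rule ccontr)
  let ?u = "word_value G square_gen u" and ?v = "word_value G square_gen v"
  assume ne: "?u \<noteq> ?v"
  have cl: "?u \<in> carrier G" "?v \<in> carrier G"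
    using uv(2,3) square_gen_closed by (auto intro: G.word_value_in_carrier[of _ "uvb_gens n"])
  have ne': "?u \<otimes> inv ?v \<noteq> \<one>"
  proof
    assume "?u \<otimes> inv ?v = \<one>"
    then have "inv (inv ?v) = ?u" using cl by (intro G.inv_equality) simp_all
    then show False using ne cl by simp
  qed
  have cl': "?u \<otimes> inv ?v \<in> carrier G" using cl by simp
  obtain N A B where AB: "A permutes {..N}" "B permutes {..N}"
    and sep: "rep N (A \<circ> A) (B \<circ> B) (?u \<otimes> inv ?v) \<noteq> \<one>\<^bsub>BijGroup (points N)\<^esub>"
    by (rule separated_by_rep[OF cl' ne'])
  interpret R1: unrestricted_virtual_braid_rep n G N A B
    using AB by (rule repI)
  interpret R2: unrestricted_virtual_braid_rep n G N "A \<circ> A" "B \<circ> B"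
    by (rule R1.square_rep)
  interpret R4: unrestricted_virtual_braid_rep n G N "(A \<circ> A) \<circ> (A \<circ> A)" "(B \<circ> B) \<circ> (B \<circ> B)"
    by (rule R2.square_rep)
  interpret h: group_hom G "BijGroup (points N)" "rep N (A \<circ> A) (B \<circ> B)"
    by (rule R2.action.group_hom)
  have "rep N (A \<circ> A) (B \<circ> B) ?u = rep N (A \<circ> A) (B \<circ> B) ?v"
    unfolding R2.rep_word_square[OF uv(2)] R2.rep_word_square[OF uv(3)]
    by (rule R4.rep_gen_relation[OF uv])
  then have "rep N (A \<circ> A) (B \<circ> B) (?u \<otimes> inv ?v) = \<one>\<^bsub>BijGroup (points N)\<^esub>"
    using cl by (simp only: h.hom_mult h.hom_inv h.hom_closed G.inv_closed h.H.r_inv)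
  with sep show False by contradiction
qed

lemma square_end_hom: "square_end \<in> hom G G"
proof -
  have "presented_lift G square_gen \<in> hom (presented_group (uvb_gens n) (uvb_rels n)) G"
    by (intro presented_lift_hom group_G square_gen_closed square_gen_relation)
  then show ?thesis by (simp only: square_end_def G_presented[symmetric])
qed

lemma square_end_gen: "x \<in> uvb_gens n \<Longrightarrow> square_end (gen x) = square_gen x"
  unfolding square_end_def gen_def presented_gen_def
  by (intro presented_lift_gen group_G square_gen_closed square_gen_relation)

lemma hom_eq_on_gens:
  assumes "group H" "h \<in> hom G H" "h' \<in> hom G H" "\<And>x. x \<in> uvb_gens n \<Longrightarrow> h (gen x) = h' (gen x)"
    and "g \<in> carrier G"
  shows "h g = h' g"
proof (rule hom_eq_on_generate[OF group_G assms(1-3)])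
  show "gen ` uvb_gens n \<subseteq> carrier G" using gen_closed by blast
  show "g \<in> generate G (gen ` uvb_gens n)" using assms(5) by (simp add: gen_generate)
qed (use assms(4) in blast)

lemma rep_square_end:
  assumes "A permutes {..N}" "B permutes {..N}" "g \<in> carrier G"
  shows "rep N A B (square_end g) = rep N (A \<circ> A) (B \<circ> B) g"
proof -
  interpret R1: unrestricted_virtual_braid_rep n G N A B
    using assms by (intro repI)
  interpret R2: unrestricted_virtual_braid_rep n G N "A \<circ> A" "B \<circ> B"
    by (rule R1.square_rep)
  have "(rep N A B \<circ> square_end) g = rep N (A \<circ> A) (B \<circ> B) g"
    by (rule hom_eq_on_gens[OF group_BijGroup Group.hom_compose[OF square_end_hom R1.rep_hom] R2.rep_hom _ assms(3)]) (simp add: square_end_gen R1.rep_square_gen R2.rep_gen)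
  then show ?thesis by simp
qed

lemma square_end_inj: "inj_on square_end (carrier G)"
proof -
  interpret s: group_hom G G square_end
    using group_G square_end_hom by (simp add: group_hom_def group_hom_axioms_def)
  show ?thesis
    unfolding s.inj_on_one_iff
  proof (intro allI impI, rule ccontr)
    fix g assume g: "g \<in> carrier G" "square_end g = \<one>" "g \<noteq> \<one>"
    obtain N A B where AB: "A permutes {..N}" "B permutes {..N}"
      and sep: "rep N (A \<circ> A) (B \<circ> B) g \<noteq> \<one>\<^bsub>BijGroup (points N)\<^esub>"
      by (rule separated_by_rep[OF g(1,3)])
    interpret R: unrestricted_virtual_braid_rep n G N A B
      using AB by (rule repI)
    interpret h: group_hom G "BijGroup (points N)" "rep N A B"
      by (rule R.action.group_hom)
    have "rep N (A \<circ> A) (B \<circ> B) g = \<one>\<^bsub>BijGroup (points N)\<^esub>"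
      by (simp only: rep_square_end[OF AB g(1), symmetric] g(2) h.hom_one)
    with sep show False by contradiction
  qed
qed

lemma perm_square_end:
  assumes "g \<in> carrier G"
  shows "perm (square_end g) = perm g"
proof -
  have hom: "perm \<in> hom G (sym_group n)" using uvb_perm_hom by (simp add: G_eq)
  have gens: "perm (square_gen x) = perm (gen x)" if "x \<in> uvb_gens n" for x
    using that by (cases x)
      (auto simp: square_gen_def perm_gen fun_eq_iff perm_mult \<sigma>_closed \<rho>_closed simp del: hom_mult)
  have "(perm \<circ> square_end) g = perm g"
    by (rule hom_eq_on_gens[OF sym_group_is_group Group.hom_compose[OF square_end_hom hom] hom _ assms]) (simp add: square_end_gen gens)
  then show ?thesis by simp
qed

text \<open>The parity of the number of letters \<open>\<sigma>\<close>, as an element of the symmetric group on two points.\<close>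

fun parity_gen :: "uvb_gen \<Rightarrow> nat \<Rightarrow> nat" where
  "parity_gen (Sig i) = transpose 1 2"
| "parity_gen (Rho i) = id"

definition parity :: "uvb_gen word set \<Rightarrow> nat \<Rightarrow> nat" where
  "parity = presented_lift (sym_group 2) parity_gen"

lemma parity_gen_closed: "parity_gen x \<in> carrier (sym_group 2)"
  by (cases x) (auto simp: sym_group_carrier permutes_id intro!: permutes_swap_id)

lemma parity_gen_relation:
  "(u, v) \<in> uvb_rels n \<Longrightarrow> word_value (sym_group 2) parity_gen u = word_value (sym_group 2) parity_gen v"
  by (auto simp: uvb_rels_def word_value_def sym_group_mult sym_group_one)

lemma parity_hom: "parity \<in> hom G (sym_group 2)"
  unfolding parity_def G_presented
  by (intro presented_lift_hom sym_group_is_group parity_gen_closed parity_gen_relation)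

lemma parity_gen: "x \<in> uvb_gens n \<Longrightarrow> parity (gen x) = parity_gen x"
  unfolding parity_def gen_def presented_gen_def
  by (intro presented_lift_gen sym_group_is_group parity_gen_closed parity_gen_relation)

text \<open>Each \<open>\<sigma>\<^sub>i\<rho>\<^sub>i\<sigma>\<^sub>i\<close> contains an even number of letters \<open>\<sigma>\<close>, whereas the base element \<open>\<sigma>\<^sub>1\<rho>\<^sub>1\<close> contains
  one.\<close>

lemma base_notin_square_end: "base \<notin> square_end ` carrier G"
proof
  interpret p: group_hom G "sym_group 2" parity
    using group_G parity_hom sym_group_is_group by (simp add: group_hom_def group_hom_axioms_def)
  assume "base \<in> square_end ` carrier G"
  then obtain g where g: "g \<in> carrier G" "base = square_end g" by blast
  have gens: "Sig 1 \<in> uvb_gens n" "Rho 1 \<in> uvb_gens n" using two_le by simp_all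
  have gens2: "parity (square_gen x) = id" if "x \<in> uvb_gens n" for x
    using that by (cases x)
      (auto simp: square_gen_def parity_gen \<sigma>_closed \<rho>_closed sym_group_mult)
  have triv: "(\<lambda>_. id) \<in> hom G (sym_group 2)"
    by (simp add: hom_def sym_group_mult sym_group_carrier permutes_id)
  have "(parity \<circ> square_end) g = (\<lambda>_. id) g"
    by (rule hom_eq_on_gens[OF sym_group_is_group Group.hom_compose[OF square_end_hom parity_hom] triv _ g(1)]) (simp add: square_end_gen gens2)
  then have "parity base = id" using g(2) by simp
  moreover have "parity base = transpose 1 2"
    using gens unfolding base_def by (simp add: gen_closed parity_gen sym_group_mult)
  ultimately have "transpose 1 2 (1 :: nat) = 1" by (metis id_apply)
  then show False by simp
qed

section \<open>Residual finiteness, Hopf and co-Hopf properties\<close>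

definition pure_kernel :: "uvb_gen word set set" where
  "pure_kernel = kernel G (sym_group n) perm"

lemma UVP_eq: "UVP n = G\<lparr>carrier := pure_kernel\<rparr>"
  unfolding UVP_def pure_kernel_def by (simp only: G_eq)

lemma pure_kernel_iff: "g \<in> pure_kernel \<longleftrightarrow> g \<in> carrier G \<and> perm g = id"
  by (simp add: pure_kernel_def kernel_def sym_group_one)

lemma subgroup_pure_kernel: "subgroup pure_kernel G"
  unfolding pure_kernel_def by (rule subgroup_kernel)

lemma residually_finite_G: "residually_finite G"
proof (rule residually_finite_if_separated[OF group_G])
  fix g assume "g \<in> carrier G" "g \<noteq> \<one>"
  then obtain N A B where AB: "A permutes {..N}" "B permutes {..N}"
    and sep: "rep N (A \<circ> A) (B \<circ> B) g \<noteq> \<one>\<^bsub>BijGroup (points N)\<^esub>"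
    by (rule separated_by_rep)
  interpret R: unrestricted_virtual_braid_rep n G N "A \<circ> A" "B \<circ> B"
    using AB by (intro repI permutes_compose)
  have "finite (carrier (BijGroup (points N)))"
  proof (rule finite_subset)
    show "carrier (BijGroup (points N)) \<subseteq> points N \<rightarrow>\<^sub>E points N"
      by (auto simp: BijGroup_def PiE_def dest: Bij_imp_extensional Bij_imp_funcset)
    show "finite (points N \<rightarrow>\<^sub>E points N)"
      by (intro finite_PiE finite_points)
  qed
  then show "\<exists>(H :: ((nat \<times> nat) \<times> nat \<Rightarrow> (nat \<times> nat) \<times> nat) monoid) h.
      group H \<and> finite (carrier H) \<and> h \<in> hom G H \<and> h g \<noteq> \<one>\<^bsub>H\<^esub>"
    by (intro exI conjI) (rule group_BijGroup, assumption, rule R.rep_hom, rule sep)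
qed

lemma hopfian_G: "hopfian G"
proof (rule finitely_generated_residually_finite_imp_hopfian[OF group_G _ _ gen_generate residually_finite_G])
  show "finite (gen ` uvb_gens n)" by (simp add: uvb_gens_def)
qed (auto simp: gen_closed)

lemma not_co_hopfian_G: "\<not> co_hopfian G"
  using square_end_hom square_end_inj base_notin_square_end base_closed
  unfolding co_hopfian_def by blast

lemma residually_finite_UVP: "residually_finite (UVP n)"
  unfolding UVP_eq
  by (rule residually_finite_subgroup[OF group_G subgroup_pure_kernel residually_finite_G])

lemma pure_gen_in_kernel: "c \<in> pairs \<Longrightarrow> pure_gen c \<in> pure_kernel"
  by (simp add: pure_kernel_iff pure_gen_closed perm_pure_gen)

lemma pure_gen_generate: "generate (UVP n) (pure_gen ` pairs) = carrier (UVP n)"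
proof -
  have "generate (UVP n) (pure_gen ` pairs) = generate G (pure_gen ` pairs)"
    unfolding UVP_eq using pure_gen_in_kernel
    by (intro G.generate_consistent subgroup_pure_kernel) blast
  also have "\<dots> = pure_kernel"
  proof
    show "generate G (pure_gen ` pairs) \<subseteq> pure_kernel"
      using pure_gen_in_kernel by (intro G.generate_subgroup_incl subgroup_pure_kernel) blast
    have "pure_value w \<in> generate G (pure_gen ` pairs)" if "w \<in> words pairs" for w
      using that
    proof (induction w)
      case (Cons l w)
      then show ?case by (cases l) (auto intro: generate.eng generate.incl generate.inv)
    qed (simp add: generate.one)
    then show "pure_kernel \<subseteq> generate G (pure_gen ` pairs)"
      using kernel_is_pure by (metis pure_kernel_iff subsetI)
  qed
  finally show ?thesis by (simp add: UVP_eq)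
qed

lemma hopfian_UVP: "hopfian (UVP n)"
proof (rule finitely_generated_residually_finite_imp_hopfian[OF group_UVP _ _ pure_gen_generate residually_finite_UVP])
  have "pairs \<subseteq> {1..n} \<times> {1..n}" by (auto simp: pairs_def)
  then show "finite (pure_gen ` pairs)" using finite_subset by blast
  show "pure_gen ` pairs \<subseteq> carrier (UVP n)"
    using pure_gen_in_kernel by (auto simp: UVP_eq)
qed

lemma not_co_hopfian_UVP: "\<not> co_hopfian (UVP n)"
proof -
  have sub: "pure_kernel \<subseteq> carrier G" by (auto simp: pure_kernel_iff)
  have "square_end \<in> hom (UVP n) (UVP n)"
    using square_end_hom by (auto simp: UVP_eq hom_def pure_kernel_iff perm_square_end)
  moreover have "inj_on square_end (carrier (UVP n))"
    using inj_on_subset[OF square_end_inj sub] by (simp add: UVP_eq)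
  moreover have "square_end ` carrier (UVP n) \<noteq> carrier (UVP n)"
  proof -
    have "pure_gen (1, 2) = base"
      using pure_gen_adjacent[of 1] two_le by (simp add: base_def numeral_2_eq_2)
    moreover have "pure_gen (1, 2) \<in> pure_kernel"
      using two_le by (intro pure_gen_in_kernel) (auto simp: pairs_def)
    ultimately have "base \<in> carrier (UVP n)" by (simp add: UVP_eq)
    moreover have "base \<notin> square_end ` carrier (UVP n)"
      using base_notin_square_end sub by (auto simp: UVP_eq)
    ultimately show ?thesis by blast
  qed
  ultimately show ?thesis unfolding co_hopfian_def by blast
qed

end

theorem corollary5p3:
  fixes n :: nat
  assumes "n \<ge> 2"
  shows "residually_finite (UVB n) \<and> hopfian (UVB n) \<and> \<not> co_hopfian (UVB n) \<and>
         residually_finite (UVP n) \<and> hopfian (UVP n) \<and> \<not> co_hopfian (UVP n)"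
proof -
  interpret unrestricted_virtual_braid n "UVB n"
    using assms by unfold_locales simp_all
  show ?thesis
    using residually_finite_G hopfian_G not_co_hopfian_G
      residually_finite_UVP hopfian_UVP not_co_hopfian_UVP
    by blast
qed

end
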